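(* Let $k \geq 2$ and $\ell \geq 1$ be integers. The map $\tau \colon F_\ell^k \to S_\ell^k$ is a bijection, where $F_\ell^k$ is the set of standard Young tableaux with $\ell$ boxes and at most $k$ rows, and $S_\ell^k$ is the set of self-conjugate admissible sequences of $k-1$ lattice paths on the colored $\ell\times\ell$ square $Y$. Hence $$|S_\ell^k| = \sum_{\lambda \vdash \ell,\ ht(\lambda) \leq k} f^\lambda .$$ In particular, for every partition $\lambda=(\lambda_1\ge\lambda_2\ge\cdots\ge\lambda_k\ge 0)$ of $\ell$, the number of self-conjugate admissible sequences of paths $p_1 \leq p_2 \leq \cdots \leq p_{k-1}$ of type $\lambda$ (that is, with $(t_0^0, t_1^0, \ldots, t_{k-1}^0)=\lambda$) is equal to the number of standard Young tableaux of shape $\lambda$.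
   Context: Fix integers $\ell\ge 1$, $k\ge 2$. Colored square: $Y$ is the $\ell\times\ell$ square made of $\ell^2$ unit boxes with corners $(0,0),(\ell,0),(0,-\ell),(\ell,-\ell)$. The box whose upper left corner is $(a,b)$ (integers $0\le a\le \ell-1$, $-(\ell-1)\le b\le 0$) has color $a+b$. For $-(\ell-1)\le j\le \ell-1$ there are $\ell-|j|$ boxes of color $j$. Lattice paths: A lattice path on $Y$ is a path from $(0,-\ell)$ to $(\ell,0)$ consisting of unit moves up or right inside $Y$. For lattice paths $p,q$ write $p\le q$ if every box above $q$ is also above $p$. Numbers $t_i^j$: Given lattice paths $p_1\le p_2\le\cdots\le p_{k-1}$ on $Y$ and $-(\ell-1)\le j\le\ell-1$, let $t_i^j$ for $2\le i\le k-1$ be the number of $j$-colored boxes between $p_{i-1}$ and $p_i$, let $t_1^j$ be the number of $j$-colored boxes below $p_1$, and let $t_0^j$ be the number of $j$-colored boxes above $p_{k-1}$. Admissible: The sequence $p_1\le\cdots\le p_{k-1}$ is admissible if (1) $p_1$ does not cross the diagonal $y=x-\ell$, meaning that $p_1$ stays weakly below this line; and (2) for all $2\le i\le k-1$ and $-(\ell-1)\le j\le \ell-1$, $$t_i^j\le\min\Big\{t_{i-1}^j,\ \ell-|j|-t_1^j-\sum_{a=1}^{i-1}t_a^j\Big\},$$ and $t_i^j\le t_i^{j-1}$ if $j>0$, and $t_i^j\le t_i^{j+1}$ if $j<0$. For an admissible sequence, $(t_0^0,t_1^0,\ldots,t_{k-1}^0)$ is a partition of $\ell$ (trailing zeros allowed),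 called the type of the sequence. Self-conjugate: A lattice path on $Y$ is self-conjugate if it is symmetric under reflection in the diagonal from $(0,0)$ to $(\ell,-\ell)$, i.e. under $(x,y)\mapsto(-y,-x)$. A sequence of lattice paths is self-conjugate if every path in it is. Tableaux: $f^\lambda$ is the number of standard Young tableaux of shape $\lambda$ (entries $1,\ldots,\ell$ each used once, increasing along rows from left to right and down columns from top to bottom; rows numbered from the top), and $ht(\lambda)$ is the number of nonzero parts (rows) of $\lambda$. The map $\tau$: For $X\in F_\ell^k$, $\tau(X)=(p_1,\ldots,p_{k-1})$ where, for $1\le i\le k-1$, the first $\ell$ moves of $p_i$ starting at $(0,-\ell)$ are given as follows: for $1\le j\le\ell$, the $j$-th move of $p_i$ is up if the entry $j$ lies in one of the rows $2,3,\ldots,i+1$ of $X$, and is right otherwise. After these $\ell$ moves the path has reached the diagonal from $(0,0)$ to $(\ell,-\ell)$, and $p_i$ is completed by reflecting this first half in that diagonal. *)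

theory Defs
  imports Main "HOL-Library.Product_Plus"
begin

type_synonym point = "int \<times> int"

text \<open>Lattice paths are lists of the visited lattice points; boxes are named by their upper left corner.\<close>

type_synonym path = "point list"

definition square :: "nat \<Rightarrow> point set" where
  "square l = {0..int l} \<times> {- int l..0}"

definition boxes :: "nat \<Rightarrow> point set" where
  "boxes l = {0..int l - 1} \<times> {- (int l - 1)..0}"

definition color :: "point \<Rightarrow> int" where
  "color = (\<lambda>(a, b). a + b)"

definition lattice_path :: "nat \<Rightarrow> path \<Rightarrow> bool" where
  "lattice_path l p \<longleftrightarrow>
     p \<noteq> [] \<and> hd p = (0, - int l) \<and> last p = (int l, 0) \<and>
     (\<forall>n. Suc n < length p \<longrightarrow> p ! Suc n - p ! n \<in> {(0, 1), (1, 0)}) \<and>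
     set p \<subseteq> square l"

text \<open>
  A path crosses the column \<open>a \<le> x \<le> a + 1\<close> along exactly one horizontal unit edge, from
  \<open>(a, h)\<close> to \<open>(a + 1, h)\<close>. The box with upper left corner \<open>(a, b)\<close> occupies the heights from
  \<open>b - 1\<close> to \<open>b\<close>, so it is above the path if \<open>h \<le> b - 1\<close> and below it if \<open>h \<ge> b\<close>.
\<close>

definition box_above :: "path \<Rightarrow> point \<Rightarrow> bool" where
  "box_above p = (\<lambda>(a, b). \<exists>h. (a, h) \<in> set p \<and> (a + 1, h) \<in> set p \<and> h \<le> b - 1)"

definition box_below :: "path \<Rightarrow> point \<Rightarrow> bool" where
  "box_below p = (\<lambda>(a, b). \<exists>h. (a, h) \<in> set p \<and> (a + 1, h) \<in> set p \<and> b \<le> h)"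

definition path_le :: "nat \<Rightarrow> path \<Rightarrow> path \<Rightarrow> bool" where
  "path_le l p q \<longleftrightarrow> (\<forall>B \<in> boxes l. box_above q B \<longrightarrow> box_above p B)"

text \<open>A sequence \<open>p\<^sub>1, \<dots>, p\<^sub>k\<^sub>-\<^sub>1\<close> is a list \<open>ps\<close>, whose \<open>i\<close>-th member counted from 1 is \<open>nth1 ps i\<close>.\<close>

abbreviation nth1 :: "'a list \<Rightarrow> nat \<Rightarrow> 'a" where
  "nth1 xs i \<equiv> xs ! (i - 1)"

definition path_chain :: "nat \<Rightarrow> nat \<Rightarrow> path list \<Rightarrow> bool" where
  "path_chain l k ps \<longleftrightarrow>
     length ps = k - 1 \<and> (\<forall>p \<in> set ps. lattice_path l p) \<and>
     (\<forall>i \<in> {2..k - 1}. path_le l (nth1 ps (i - 1)) (nth1 ps i))"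

definition tnum :: "nat \<Rightarrow> path list \<Rightarrow> nat \<Rightarrow> int \<Rightarrow> nat" where
  "tnum l ps i j = card {B \<in> boxes l. color B = j \<and>
     (if i = 0 then box_above (last ps) B
      else if i = 1 then box_below (nth1 ps 1) B
      else box_above (nth1 ps (i - 1)) B \<and> box_below (nth1 ps i) B)}"

definition admissible :: "nat \<Rightarrow> nat \<Rightarrow> path list \<Rightarrow> bool" where
  "admissible l k ps \<longleftrightarrow>
     path_chain l k ps \<and>
     (\<forall>(x, y) \<in> set (nth1 ps 1). y \<le> x - int l) \<and>
     (\<forall>i \<in> {2..k - 1}. \<forall>j \<in> {- (int l - 1)..int l - 1}.
        int (tnum l ps i j) \<le>
          min (int (tnum l ps (i - 1) j))
              (int l - \<bar>j\<bar> - int (tnum l ps 1 j) - (\<Sum>a = 1..i - 1. int (tnum l ps a j))) \<and>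
        (j > 0 \<longrightarrow> tnum l ps i j \<le> tnum l ps i (j - 1)) \<and>
        (j < 0 \<longrightarrow> tnum l ps i j \<le> tnum l ps i (j + 1)))"

definition seq_type :: "nat \<Rightarrow> nat \<Rightarrow> path list \<Rightarrow> nat list" where
  "seq_type l k ps = map (\<lambda>i. tnum l ps i 0) [0..<k]"

definition reflect :: "point \<Rightarrow> point" where
  "reflect = (\<lambda>(x, y). (- y, - x))"

definition self_conjugate :: "path \<Rightarrow> bool" where
  "self_conjugate p \<longleftrightarrow> reflect ` set p = set p"

definition SC_admissible :: "nat \<Rightarrow> nat \<Rightarrow> path list set" where
  "SC_admissible l k = {ps. admissible l k ps \<and> (\<forall>p \<in> set ps. self_conjugate p)}"

text \<open>Partitions may have trailing zeros, which neither \<open>ht\<close> nor \<open>SYT_shape\<close> sees.\<close>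

definition is_partition :: "nat \<Rightarrow> nat list \<Rightarrow> bool" where
  "is_partition n lam \<longleftrightarrow> sorted_wrt (\<ge>) lam \<and> sum_list lam = n"

definition ht :: "nat list \<Rightarrow> nat" where
  "ht lam = length (filter (\<lambda>m. m \<noteq> 0) lam)"

text \<open>A tableau is the list of its nonempty rows, from top to bottom.\<close>

type_synonym tableau = "nat list list"

definition standard_tableau :: "tableau \<Rightarrow> bool" where
  "standard_tableau X \<longleftrightarrow>
     [] \<notin> set X \<and> sorted_wrt (\<ge>) (map length X) \<and>
     distinct (concat X) \<and> set (concat X) = {1..length (concat X)} \<and>
     (\<forall>R \<in> set X. sorted_wrt (<) R) \<and>
     (\<forall>r c. Suc r < length X \<and> c < length (X ! Suc r) \<longrightarrow> X ! r ! c < X ! Suc r ! c)"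

definition SYT_max_rows :: "nat \<Rightarrow> nat \<Rightarrow> tableau set" where
  "SYT_max_rows l k = {X. standard_tableau X \<and> length (concat X) = l \<and> length X \<le> k}"

definition SYT_shape :: "nat list \<Rightarrow> tableau set" where
  "SYT_shape lam = {X. standard_tableau X \<and> map length X = filter (\<lambda>m. m \<noteq> 0) lam}"

definition num_SYT :: "nat list \<Rightarrow> nat" where
  "num_SYT lam = card (SYT_shape lam)"

definition tau_move :: "tableau \<Rightarrow> nat \<Rightarrow> nat \<Rightarrow> point" where
  "tau_move X i j =
     (if \<exists>r \<in> {2..i + 1}. r \<le> length X \<and> j \<in> set (nth1 X r) then (0, 1) else (1, 0))"

definition tau_half :: "nat \<Rightarrow> tableau \<Rightarrow> nat \<Rightarrow> path" where
  "tau_half l X i = map (\<lambda>n. (0, - int l) + (\<Sum>j = 1..n. tau_move X i j)) [0..<Suc l]"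

text \<open>The mirror image is traversed backwards, without repeating the point on the diagonal.\<close>

definition tau_path :: "nat \<Rightarrow> tableau \<Rightarrow> nat \<Rightarrow> path" where
  "tau_path l X i = tau_half l X i @ tl (rev (map reflect (tau_half l X i)))"

definition tau :: "nat \<Rightarrow> nat \<Rightarrow> tableau \<Rightarrow> path list" where
  "tau l k X = map (tau_path l X) [1..<k]"

end

theory Submission
  imports Defs
begin

text \<open>
  The map \<open>\<tau>\<close> factors through ballot words. A standard tableau with \<open>l\<close> boxes and at most \<open>k\<close> rows is
  recorded by the word whose \<open>j\<close>-th letter is the row, numbered from \<open>0\<close>, that contains the entry
  \<open>j\<close>. The columns increase exactly when each prefix of the word contains every letter \<open>r\<close> at least
  as often as \<open>r + 1\<close> (\<open>columns_increase_iff_counts_dominate\<close>, \<open>bij_betw_row_word\<close>).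

  A self-conjugate path is determined by its first \<open>l\<close> moves. If \<open>u\<^sub>i n\<close> is the number of up moves among
  the first \<open>n\<close> moves of \<open>p\<^sub>i\<close>, then \<open>p\<^sub>i\<close> meets the diagonal of the color \<open>j\<close> in a single vertex, whose
  position is given by \<open>u\<^sub>i n\<close> with \<open>n = l - \<bar>j\<bar>\<close>. Therefore \<open>t\<^sub>i\<^sup>j = u\<^sub>i n - u\<^sub>i\<^sub>-\<^sub>1 n\<close> for
  \<open>i \<ge> 1\<close>, with \<open>u\<^sub>0 = 0\<close>, and \<open>t\<^sub>0\<^sup>j = n - u\<^sub>k\<^sub>-\<^sub>1 n\<close> (\<open>tnum_symmetric_paths\<close>). In these terms
  admissibility says that the numbers \<open>t\<^sub>0, \<dots>, t\<^sub>k\<^sub>-\<^sub>1\<close> decrease weakly at each \<open>n\<close> and do not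
  shrink as \<open>n\<close> grows (\<open>admissible_symmetric_paths_iff\<close>). They add up to \<open>n\<close>, so at each step exactly
  one of them grows by one; the sequence of the indices that grow is a word, its prefix counts are the \<open>t\<^sub>i\<close>,
  and the weak decrease is the ballot condition (\<open>bij_betw_paths_of_word\<close>).

  The composition of these two bijections is \<open>\<tau>\<close>. The type of a sequence consists of the letter counts of the
  whole word, which are the row lengths of the tableau, so \<open>\<tau>\<close> restricts to a bijection for each shape.
\<close>

section \<open>Vertices of lattice paths and sides of boxes\<close>

lemma lattice_path_diagonal:
  assumes "lattice_path l p" "n < length p"
  shows "fst (p ! n) + snd (p ! n) = int n - int l"
  using assms(2)
proof (induction n)
  case 0
  then show ?case using assms(1) by (simp add: lattice_path_def hd_conv_nth)
next
  case (Suc n)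
  have "p ! Suc n - p ! n \<in> {(0, 1), (1, 0)}"
    using assms(1) Suc.prems by (simp add: lattice_path_def)
  then have "fst (p ! Suc n - p ! n) + snd (p ! Suc n - p ! n) = 1"
    by (auto simp: prod_eq_iff)
  then show ?case using Suc by simp
qed

lemma lattice_path_length:
  assumes "lattice_path l p"
  shows "length p = 2 * l + 1"
proof -
  have "p \<noteq> []" and last: "last p = (int l, 0)" using assms by (auto simp: lattice_path_def)
  then have "p ! (length p - 1) = (int l, 0)" and "length p > 0" by (simp_all add: last_conv_nth)
  then have "2 * int l = int (length p - 1)"
    using lattice_path_diagonal[OF assms, of "length p - 1"] by simp
  then show ?thesis using \<open>length p > 0\<close> by linarith
qed

lemma lattice_path_ends:
  assumes "lattice_path l p"
  shows "p ! 0 = (0, - int l)" "p ! (2 * l) = (int l, 0)"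
proof -
  have "p \<noteq> []" using assms by (auto simp: lattice_path_def)
  then show "p ! 0 = (0, - int l)" "p ! (2 * l) = (int l, 0)"
    using assms lattice_path_length[OF assms] by (auto simp: lattice_path_def hd_conv_nth last_conv_nth)
qed

lemma lattice_path_step:
  assumes "lattice_path l p" "n < 2 * l"
  shows "p ! Suc n = p ! n + (0, 1) \<or> p ! Suc n = p ! n + (1, 0)"
proof -
  have "p ! Suc n - p ! n \<in> {(0, 1), (1, 0)}"
    using assms lattice_path_length[OF assms(1)] by (simp add: lattice_path_def)
  then show ?thesis by (auto simp: diff_eq_eq add.commute)
qed

lemma lattice_path_fst_mono:
  assumes "lattice_path l p" "m \<le> n" "n \<le> 2 * l"
  shows "fst (p ! m) \<le> fst (p ! n)"
  using assms(2,3)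
proof (induction rule: dec_induct)
  case (step n)
  then show ?case using lattice_path_step[OF assms(1), of n] by auto
qed simp

lemma mem_lattice_path_iff:
  assumes "lattice_path l p"
  shows "(x, y) \<in> set p \<longleftrightarrow>
    0 \<le> x + y + int l \<and> x + y \<le> int l \<and> p ! nat (x + y + int l) = (x, y)"
proof
  assume "(x, y) \<in> set p"
  then obtain n where n: "n < length p" "p ! n = (x, y)" by (auto simp: in_set_conv_nth)
  then have "x + y + int l = int n" using lattice_path_diagonal[OF assms n(1)] by simp
  then show "0 \<le> x + y + int l \<and> x + y \<le> int l \<and> p ! nat (x + y + int l) = (x, y)"
    using n lattice_path_length[OF assms] by auto
next
  assume *: "0 \<le> x + y + int l \<and> x + y \<le> int l \<and> p ! nat (x + y + int l) = (x, y)"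
  then have "nat (x + y + int l) < length p" using lattice_path_length[OF assms] by auto
  then show "(x, y) \<in> set p" using * by (metis nth_mem)
qed

text \<open>
  The diagonal from upper left to lower right of a box of color \<open>j\<close> lies on the line
  \<open>x + y = j\<close>, and a path meets this line exactly once, after \<open>l + j\<close> moves. So that single
  vertex decides on which side of the path each box of color \<open>j\<close> lies.
\<close>

lemma box_side_iff:
  assumes p: "lattice_path l p" and B: "(a, b) \<in> boxes l"
  shows "box_below p (a, b) \<longleftrightarrow> fst (p ! nat (int l + (a + b))) \<le> a"
    and "box_above p (a, b) \<longleftrightarrow> a < fst (p ! nat (int l + (a + b)))"
proof -
  have ab: "0 \<le> a" "a \<le> int l - 1" "- (int l - 1) \<le> b" "b \<le> 0"
    using B by (auto simp: boxes_def)
  define m where "m = nat (int l + (a + b))"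
  have m: "int m = int l + (a + b)" "m \<le> 2 * l" using ab by (auto simp: m_def)
  have edge: "\<exists>s<2 * l. s = nat (a + h + int l) \<and> int s = a + h + int l \<and>
      fst (p ! s) = a \<and> fst (p ! Suc s) = a + 1"
    if "(a, h) \<in> set p" "(a + 1, h) \<in> set p" for h
  proof -
    have "0 \<le> a + h + int l" "p ! nat (a + h + int l) = (a, h)"
      "a + 1 + h \<le> int l" "p ! nat (a + 1 + h + int l) = (a + 1, h)"
      using that by (auto simp: mem_lattice_path_iff[OF p])
    moreover have "nat (a + 1 + h + int l) = Suc (nat (a + h + int l))"
      using \<open>0 \<le> a + h + int l\<close> by simp
    ultimately show ?thesis by (intro exI[of _ "nat (a + h + int l)"]) auto
  qed
  have below: "fst (p ! m) \<le> a" if side: "box_below p (a, b)"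
  proof -
    obtain h where h: "(a, h) \<in> set p" "(a + 1, h) \<in> set p" "b \<le> h"
      using side by (auto simp: box_below_def)
    obtain s where s: "s < 2 * l" "int s = a + h + int l" "fst (p ! s) = a"
      using edge[OF h(1,2)] by auto
    then have "m \<le> s" using m h(3) by simp
    then show ?thesis using lattice_path_fst_mono[OF p, of m s] s by simp
  qed
  have above: "a < fst (p ! m)" if side: "box_above p (a, b)"
  proof -
    obtain h where h: "(a, h) \<in> set p" "(a + 1, h) \<in> set p" "h \<le> b - 1"
      using side by (auto simp: box_above_def)
    obtain s where s: "s < 2 * l" "int s = a + h + int l" "fst (p ! Suc s) = a + 1"
      using edge[OF h(1,2)] by auto
    then have "Suc s \<le> m" using m h(3) by simp
    then show ?thesis using lattice_path_fst_mono[OF p, of "Suc s" m] s m by simp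
  qed
  have either: "box_below p (a, b) \<or> box_above p (a, b)"
  proof -
    \<comment> \<open>The move that leaves the column of the box is horizontal, so it is the edge sought.\<close>
    define s where "s = (LEAST s. a < fst (p ! Suc s))"
    have ex: "a < fst (p ! Suc (2 * l - 1))"
      using ab lattice_path_ends[OF p] by (cases l) auto
    have s: "a < fst (p ! Suc s)" and le: "s \<le> 2 * l - 1"
      unfolding s_def using ex by (auto intro: LeastI Least_le)
    have "l > 0" using ab by simp
    then have sl: "s < 2 * l" using le by simp
    have "fst (p ! s) \<le> a"
    proof (cases s)
      case 0
      then show ?thesis using ab lattice_path_ends[OF p] by simp
    next
      case (Suc s')
      then show ?thesis using not_less_Least[of s' "\<lambda>s. a < fst (p ! Suc s)"]
        by (simp add: s_def not_less)
    qed
    then have st: "p ! s = (a, snd (p ! s))" "p ! Suc s = (a + 1, snd (p ! s))"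
      using s lattice_path_step[OF p sl] by (auto simp: prod_eq_iff)
    moreover have "p ! s \<in> set p" "p ! Suc s \<in> set p"
      using sl lattice_path_length[OF p] by auto
    ultimately have "(a, snd (p ! s)) \<in> set p" "(a + 1, snd (p ! s)) \<in> set p" by auto
    then show ?thesis unfolding box_below_def box_above_def by fastforce
  qed
  show "box_below p (a, b) \<longleftrightarrow> fst (p ! nat (int l + (a + b))) \<le> a"
    and "box_above p (a, b) \<longleftrightarrow> a < fst (p ! nat (int l + (a + b)))"
    using below above either unfolding m_def[symmetric] by auto
qed

section \<open>Self-conjugate paths\<close>

text \<open>
  A self-conjugate path is determined by its first \<open>l\<close> moves, and these by the number \<open>u n\<close> of
  up moves among the first \<open>n\<close>. These are the functions \<open>u\<close> that occur; their values beyond \<open>l\<close>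
  are left free.
\<close>

definition unit_steps :: "nat \<Rightarrow> (nat \<Rightarrow> nat) \<Rightarrow> bool" where
  "unit_steps l u \<longleftrightarrow> u 0 = 0 \<and> (\<forall>n<l. u (Suc n) = u n \<or> u (Suc n) = Suc (u n))"

definition half_vertex :: "nat \<Rightarrow> (nat \<Rightarrow> nat) \<Rightarrow> nat \<Rightarrow> point" where
  "half_vertex l u n = (int n - int (u n), int (u n) - int l)"

definition symmetric_path :: "nat \<Rightarrow> (nat \<Rightarrow> nat) \<Rightarrow> path" where
  "symmetric_path l u =
    map (\<lambda>n. if n \<le> l then half_vertex l u n else reflect (half_vertex l u (2 * l - n)))
      [0..<2 * l + 1]"

lemma unit_steps_le:
  assumes "unit_steps l u" "n \<le> l"
  shows "u n \<le> n"
  using assms(2)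
proof (induction n)
  case (Suc n)
  then have "u (Suc n) = u n \<or> u (Suc n) = Suc (u n)" using assms(1) by (simp add: unit_steps_def)
  then show ?case using Suc by auto
qed (use assms(1) in \<open>simp add: unit_steps_def\<close>)

lemma length_symmetric_path [simp]: "length (symmetric_path l u) = 2 * l + 1"
  by (simp add: symmetric_path_def)

lemma symmetric_path_nth:
  "n \<le> l \<Longrightarrow> symmetric_path l u ! n = half_vertex l u n"
  "n \<le> l \<Longrightarrow> symmetric_path l u ! (2 * l - n) = reflect (half_vertex l u n)"
proof -
  show "n \<le> l \<Longrightarrow> symmetric_path l u ! n = half_vertex l u n"
    by (simp add: symmetric_path_def del: upt_Suc)
  show "n \<le> l \<Longrightarrow> symmetric_path l u ! (2 * l - n) = reflect (half_vertex l u n)"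
    by (cases "n = l") (auto simp: symmetric_path_def half_vertex_def reflect_def simp del: upt_Suc)
qed

lemma reflect_reflect [simp]: "reflect (reflect q) = q"
  by (cases q) (simp add: reflect_def)

lemma reflect_symmetric_path_nth:
  assumes "n \<le> 2 * l"
  shows "symmetric_path l u ! (2 * l - n) = reflect (symmetric_path l u ! n)"
proof (cases "n \<le> l")
  case False
  then have "2 * l - n \<le> l" "2 * l - (2 * l - n) = n" using assms by auto
  then show ?thesis using symmetric_path_nth[of "2 * l - n" l u] by simp
qed (simp add: symmetric_path_nth)

lemma lattice_path_symmetric_path:
  assumes u: "unit_steps l u"
  shows "lattice_path l (symmetric_path l u)"
proof -
  let ?p = "symmetric_path l u"
  have ne: "?p \<noteq> []" using length_symmetric_path[of l u] by (metis add_is_0 length_0_conv one_neq_zero)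
  have u0: "u 0 = 0" using u by (simp add: unit_steps_def)
  have "?p ! 0 = (0, - int l)"
    using symmetric_path_nth(1)[of 0 l u] u0 by (simp add: half_vertex_def)
  moreover have "?p ! (2 * l) = (int l, 0)"
    using symmetric_path_nth(2)[of 0 l u] u0 by (simp add: half_vertex_def reflect_def)
  moreover have "?p ! Suc n - ?p ! n \<in> {(0, 1), (1, 0)}" if "n < 2 * l" for n
  proof (cases "n < l")
    case True
    then have "u (Suc n) = u n \<or> u (Suc n) = Suc (u n)" using u by (simp add: unit_steps_def)
    then show ?thesis using True
      by (auto simp: symmetric_path_nth half_vertex_def)
  next
    case False
    define m where "m = 2 * l - Suc n"
    have m: "m < l" "n = 2 * l - Suc m" "Suc n = 2 * l - m"
      using False that by (auto simp: m_def)
    have "u (Suc m) = u m \<or> u (Suc m) = Suc (u m)" using u m(1) by (simp add: unit_steps_def)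
    then show ?thesis using m(1)
      unfolding m(3) by (subst m(2)) (auto simp: symmetric_path_nth half_vertex_def reflect_def)
  qed
  moreover have "set ?p \<subseteq> square l"
  proof
    fix q assume "q \<in> set ?p"
    then obtain n where n: "n \<le> 2 * l" "q = ?p ! n" by (auto simp: in_set_conv_nth less_Suc_eq_le)
    have half: "half_vertex l u m \<in> square l \<and> reflect (half_vertex l u m) \<in> square l" if "m \<le> l" for m
      using unit_steps_le[OF u that] that by (auto simp: half_vertex_def square_def reflect_def)
    show "q \<in> square l"
    proof (cases "n \<le> l")
      case True
      then show ?thesis using half n by (simp add: symmetric_path_nth)
    next
      case False
      then show ?thesis
        using half[of "2 * l - n"] n symmetric_path_nth(2)[of "2 * l - n" l u] by simp
    qed
  qed
  ultimately show ?thesis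
    using ne by (simp add: lattice_path_def hd_conv_nth last_conv_nth)
qed

lemma self_conjugate_symmetric_path: "self_conjugate (symmetric_path l u)"
proof -
  let ?p = "symmetric_path l u"
  have sub: "reflect ` set ?p \<subseteq> set ?p"
  proof
    fix q assume "q \<in> reflect ` set ?p"
    then obtain n where n: "n \<le> 2 * l" "q = reflect (?p ! n)"
      by (auto simp: in_set_conv_nth less_Suc_eq_le)
    then have "q = ?p ! (2 * l - n)" by (simp add: reflect_symmetric_path_nth)
    then show "q \<in> set ?p" by (simp add: in_set_conv_nth less_Suc_eq_le) (metis diff_le_self)
  qed
  then have "set ?p \<subseteq> reflect ` set ?p" by (metis image_iff image_subset_iff reflect_reflect subsetI)
  with sub show ?thesis by (simp add: self_conjugate_def)
qed

text \<open>
  Reflection negates \<open>x + y\<close>, so it sends the vertex reached after \<open>n\<close> moves to the one reached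
  after \<open>2 * l - n\<close> moves: invariance of the vertex set already reverses the whole path.
\<close>

lemma self_conjugate_path_eq_symmetric_path:
  assumes p: "lattice_path l p" and sc: "self_conjugate p"
  obtains u where "unit_steps l u" "p = symmetric_path l u"
proof
  define u where "u n = nat (snd (p ! n) + int l)" for n
  have len: "length p = 2 * l + 1" by (rule lattice_path_length[OF p])
  have nonneg: "snd (p ! n) + int l \<ge> 0" if "n \<le> 2 * l" for n
  proof -
    have "p ! n \<in> square l" using p that len by (metis lattice_path_def less_Suc_eq_le nth_mem subsetD Suc_eq_plus1)
    then show ?thesis by (auto simp: square_def)
  qed
  show "unit_steps l u"
    unfolding unit_steps_def
  proof (intro conjI allI impI)
    show "u 0 = 0" using lattice_path_ends[OF p] by (simp add: u_def)
    show "u (Suc n) = u n \<or> u (Suc n) = Suc (u n)" if "n < l" for n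
      using lattice_path_step[OF p, of n] that nonneg[of n] by (auto simp: u_def)
  qed
  have half: "p ! n = half_vertex l u n" if "n \<le> l" for n
    using lattice_path_diagonal[OF p, of n] nonneg[of n] that len
    by (auto simp: half_vertex_def u_def prod_eq_iff)
  have refl: "p ! (2 * l - n) = reflect (p ! n)" if "n \<le> 2 * l" for n
  proof -
    have d: "fst (p ! n) + snd (p ! n) = int n - int l"
      using lattice_path_diagonal[OF p, of n] that len by simp
    have "p ! n \<in> set p" using that len by simp
    then have "reflect (p ! n) \<in> set p" using sc by (metis imageI self_conjugate_def)
    then have "(- snd (p ! n), - fst (p ! n)) \<in> set p" by (simp add: reflect_def split_beta)
    then have "p ! nat (- snd (p ! n) - fst (p ! n) + int l) = reflect (p ! n)"
      by (simp add: mem_lattice_path_iff[OF p] reflect_def split_beta)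
    moreover have "nat (- snd (p ! n) - fst (p ! n) + int l) = 2 * l - n" using d by simp
    ultimately show ?thesis by simp
  qed
  show "p = symmetric_path l u"
  proof (rule nth_equalityI)
    show "length p = length (symmetric_path l u)" by (simp add: len)
    show "p ! n = symmetric_path l u ! n" if "n < length p" for n
    proof (cases "n \<le> l")
      case True
      then show ?thesis by (simp add: half symmetric_path_nth)
    next
      case False
      then have m: "2 * l - n \<le> l" "2 * l - (2 * l - n) = n" using that len by auto
      then show ?thesis
        using refl[of "2 * l - n"] symmetric_path_nth(2)[OF m(1), of u] half[OF m(1)] by simp
    qed
  qed
qed

section \<open>Box counts and admissibility\<close>

text \<open>
  The boxes of color \<open>j\<close> occupy \<open>l - \<bar>j\<bar>\<close> consecutive columns starting at \<open>max 0 j\<close>. Counted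
  from the right end of this range, the path meets the line \<open>x + y = j\<close> at distance
  \<open>u (l - \<bar>j\<bar>)\<close>; by symmetry both signs of \<open>j\<close> give one formula.
\<close>

lemma fst_symmetric_path_nth:
  assumes "- int l \<le> j" "j \<le> int l"
  shows "fst (symmetric_path l u ! nat (int l + j)) = max 0 j + (int l - \<bar>j\<bar>) - int (u (nat (int l - \<bar>j\<bar>)))"
proof (cases "j \<le> 0")
  case True
  then show ?thesis using assms symmetric_path_nth(1)[of "nat (int l + j)" l u]
    by (simp add: half_vertex_def)
next
  case False
  then have "nat (int l - j) \<le> l" "2 * l - nat (int l - j) = nat (int l + j)" using assms by auto
  then show ?thesis using False assms symmetric_path_nth(2)[of "nat (int l - j)" l u]
    by (simp add: half_vertex_def reflect_def)
qed

lemma box_side_symmetric_path: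
  assumes u: "unit_steps l u" and B: "(a, j - a) \<in> boxes l"
  shows "box_below (symmetric_path l u) (a, j - a) \<longleftrightarrow>
      max 0 j + (int l - \<bar>j\<bar>) - int (u (nat (int l - \<bar>j\<bar>))) \<le> a"
    and "box_above (symmetric_path l u) (a, j - a) \<longleftrightarrow>
      a < max 0 j + (int l - \<bar>j\<bar>) - int (u (nat (int l - \<bar>j\<bar>)))"
proof -
  have j: "- int l \<le> j" "j \<le> int l" using B by (auto simp: boxes_def)
  have "nat (int l + (a + (j - a))) = nat (int l + j)" by simp
  then show "box_below (symmetric_path l u) (a, j - a) \<longleftrightarrow>
      max 0 j + (int l - \<bar>j\<bar>) - int (u (nat (int l - \<bar>j\<bar>))) \<le> a"
    and "box_above (symmetric_path l u) (a, j - a) \<longleftrightarrow>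
      a < max 0 j + (int l - \<bar>j\<bar>) - int (u (nat (int l - \<bar>j\<bar>)))"
    using box_side_iff[OF lattice_path_symmetric_path[OF u] B] fst_symmetric_path_nth[OF j, of u]
    by simp_all
qed

lemma boxes_of_color_iff:
  "(a, j - a) \<in> boxes l \<longleftrightarrow> max 0 j \<le> a \<and> a < max 0 j + (int l - \<bar>j\<bar>)"
  by (auto simp: boxes_def)

text \<open>
  Every region that the numbers \<open>t\<^sub>i\<^sup>j\<close> count meets the boxes of color \<open>j\<close> in an interval of
  columns.
\<close>

lemma card_boxes_of_color:
  assumes "\<And>a. (a, j - a) \<in> boxes l \<Longrightarrow> P (a, j - a) \<longleftrightarrow> c \<le> a \<and> a < d"
    and "max 0 j \<le> c" "d \<le> max 0 j + (int l - \<bar>j\<bar>)"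
  shows "card {B \<in> boxes l. color B = j \<and> P B} = nat (d - c)"
proof -
  have "{B \<in> boxes l. color B = j \<and> P B} = (\<lambda>a. (a, j - a)) ` {c..<d}" (is "?L = ?R")
  proof
    show "?L \<subseteq> ?R"
    proof
      fix B assume B: "B \<in> ?L"
      then have "B = (fst B, j - fst B)" by (auto simp: color_def split_beta)
      then show "B \<in> ?R" using B assms(1)[of "fst B"] by (auto intro!: image_eqI)
    qed
    show "?R \<subseteq> ?L"
    proof
      fix B assume "B \<in> ?R"
      then obtain a where a: "B = (a, j - a)" "c \<le> a" "a < d" by auto
      then have "(a, j - a) \<in> boxes l" using assms(2,3) unfolding boxes_of_color_iff by simp
      then show "B \<in> ?L" using a assms(1) by (auto simp: color_def)
    qed
  qed
  moreover have "inj_on (\<lambda>a. (a, j - a)) {c..<d}" by (auto intro: inj_onI)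
  ultimately show ?thesis by (simp add: card_image)
qed

definition symmetric_paths :: "nat \<Rightarrow> nat \<Rightarrow> (nat \<Rightarrow> nat \<Rightarrow> nat) \<Rightarrow> path list" where
  "symmetric_paths l k u = map (\<lambda>i. symmetric_path l (u i)) [1..<k]"

text \<open>
  For the paths with up move counts \<open>u 1, \<dots>, u (k - 1)\<close>, this is the number \<open>t\<^sub>i\<^sup>j\<close> with
  \<open>n = l - \<bar>j\<bar>\<close>. The convention \<open>u 0 = 0\<close> makes the case \<open>i = 1\<close> uniform with the later ones.
\<close>

definition gap :: "nat \<Rightarrow> (nat \<Rightarrow> nat \<Rightarrow> nat) \<Rightarrow> nat \<Rightarrow> nat \<Rightarrow> nat" where
  "gap k u i n = (if i = 0 then n - u (k - 1) n else u i n - u (i - 1) n)"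

lemma nth1_symmetric_paths:
  "1 \<le> i \<Longrightarrow> i < k \<Longrightarrow> nth1 (symmetric_paths l k u) i = symmetric_path l (u i)"
  using nth_upt[of 1 "i - 1" k] by (simp add: symmetric_paths_def)

lemma last_symmetric_paths:
  "2 \<le> k \<Longrightarrow> last (symmetric_paths l k u) = symmetric_path l (u (k - 1))"
  by (simp add: symmetric_paths_def last_map)

lemma tnum_symmetric_paths:
  assumes k: "2 \<le> k" and u: "\<And>i. i < k \<Longrightarrow> unit_steps l (u i)" and u0: "\<And>n. u 0 n = 0"
    and i: "i < k" and j: "j \<in> {- (int l - 1)..int l - 1}"
  shows "tnum l (symmetric_paths l k u) i j = gap k u i (nat (int l - \<bar>j\<bar>))"
proof -
  define n where "n = nat (int l - \<bar>j\<bar>)"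
  have n: "int n = int l - \<bar>j\<bar>" "n \<le> l" using j by (auto simp: n_def)
  let ?x = "\<lambda>i. max 0 j + int n - int (u i n)"
  have le: "int (u i n) \<le> int l - \<bar>j\<bar>" if "i < k" for i
    using unit_steps_le[OF u[OF that] n(2)] n(1) by linarith
  have side: "box_below (symmetric_path l (u i)) (a, j - a) \<longleftrightarrow> ?x i \<le> a"
      "box_above (symmetric_path l (u i)) (a, j - a) \<longleftrightarrow> a < ?x i"
    if "i < k" "(a, j - a) \<in> boxes l" for i a
    using box_side_symmetric_path[OF u[OF that(1)] that(2)] unfolding n_def[symmetric] n(1) by auto
  consider "i = 0" | "i = 1" | "2 \<le> i" by linarith
  then show ?thesis
  proof cases
    case 1
    have "tnum l (symmetric_paths l k u) i j = nat (?x (k - 1) - max 0 j)"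
      unfolding tnum_def using 1 k side(2)[of "k - 1"] le[of "k - 1"]
      by (intro card_boxes_of_color)
        (auto simp: last_symmetric_paths boxes_of_color_iff n(1))
    then show ?thesis using 1 unfolding n_def[symmetric] by (simp add: gap_def)
  next
    case 2
    have "tnum l (symmetric_paths l k u) i j = nat (max 0 j + int n - ?x 1)"
      unfolding tnum_def using 2 k side(1)[of 1] le[of 1] nth1_symmetric_paths[of 1 k l u]
      by (intro card_boxes_of_color)
        (auto simp: boxes_of_color_iff n(1))
    then show ?thesis using 2 u0 unfolding n_def[symmetric] by (simp add: gap_def)
  next
    case 3
    have "tnum l (symmetric_paths l k u) i j = nat (?x (i - 1) - ?x i)"
      unfolding tnum_def using 3 i side(1)[of i] side(2)[of "i - 1"] le[of i] le[of "i - 1"]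
        nth1_symmetric_paths[of i k l u] nth1_symmetric_paths[of "i - 1" k l u]
      by (intro card_boxes_of_color)
        (auto simp: boxes_of_color_iff n(1))
    then show ?thesis using 3 unfolding n_def[symmetric] by (simp add: gap_def)
  qed
qed

text \<open>
  If \<open>p\<close> runs strictly above \<open>q\<close> after \<open>n \<le> l\<close> moves, then the box whose upper left corner is
  the vertex of \<open>p\<close> there is above \<open>q\<close> but not above \<open>p\<close>.
\<close>

lemma path_le_symmetric_path_iff:
  assumes u: "unit_steps l u" and v: "unit_steps l v"
  shows "path_le l (symmetric_path l u) (symmetric_path l v) \<longleftrightarrow> (\<forall>n\<le>l. u n \<le> v n)"
proof
  assume le: "path_le l (symmetric_path l u) (symmetric_path l v)"
  show "\<forall>n\<le>l. u n \<le> v n"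
  proof (intro allI impI)
    fix n assume n: "n \<le> l"
    define j where "j = int n - int l"
    define a where "a = int n - int (u n)"
    have j: "nat (int l - \<bar>j\<bar>) = n" "max 0 j + (int l - \<bar>j\<bar>) = int n" using n by (auto simp: j_def)
    show "u n \<le> v n"
    proof (rule ccontr)
      assume "\<not> u n \<le> v n"
      then have B: "(a, j - a) \<in> boxes l" unfolding boxes_of_color_iff
        using unit_steps_le[OF u n] n by (auto simp: a_def j_def)
      have "box_above (symmetric_path l v) (a, j - a)"
        unfolding box_side_symmetric_path(2)[OF v B] j using \<open>\<not> u n \<le> v n\<close> by (simp add: a_def)
      then have "box_above (symmetric_path l u) (a, j - a)" using le B by (auto simp: path_le_def)
      then show False unfolding box_side_symmetric_path(2)[OF u B] j by (simp add: a_def)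
    qed
  qed
next
  assume le: "\<forall>n\<le>l. u n \<le> v n"
  show "path_le l (symmetric_path l u) (symmetric_path l v)"
    unfolding path_le_def
  proof (intro ballI impI)
    fix B assume B: "B \<in> boxes l" and above: "box_above (symmetric_path l v) B"
    define a j where "a = fst B" and "j = fst B + snd B"
    have Ba: "B = (a, j - a)" by (simp add: a_def j_def prod_eq_iff)
    have "u (nat (int l - \<bar>j\<bar>)) \<le> v (nat (int l - \<bar>j\<bar>))" using le by simp
    then show "box_above (symmetric_path l u) B" using above B unfolding Ba
      by (simp add: box_side_symmetric_path(2)[OF u] box_side_symmetric_path(2)[OF v])
  qed
qed

lemma below_diagonal_symmetric_path_iff:
  "(\<forall>(x, y) \<in> set (symmetric_path l u). y \<le> x - int l) \<longleftrightarrow> (\<forall>n\<le>l. 2 * u n \<le> n)"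
proof -
  have "(\<forall>(x, y) \<in> set (symmetric_path l u). y \<le> x - int l) \<longleftrightarrow>
      (\<forall>n\<le>2 * l. snd (symmetric_path l u ! n) \<le> fst (symmetric_path l u ! n) - int l)"
    by (auto simp: all_set_conv_all_nth split_beta less_Suc_eq_le)
  also have "\<dots> \<longleftrightarrow> (\<forall>n\<le>l. snd (half_vertex l u n) \<le> fst (half_vertex l u n) - int l)"
    (is "?L \<longleftrightarrow> ?R")
  proof
    show "?R" if ?L
    proof (intro allI impI)
      fix n assume "n \<le> l"
      then show "snd (half_vertex l u n) \<le> fst (half_vertex l u n) - int l"
        using that[rule_format, of n] by (simp add: symmetric_path_nth)
    qed
    show "?L" if ?R
    proof (intro allI impI)
      fix n assume n: "n \<le> 2 * l"
      show "snd (symmetric_path l u ! n) \<le> fst (symmetric_path l u ! n) - int l"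
      proof (cases "n \<le> l")
        case True
        then show ?thesis using that by (simp add: symmetric_path_nth)
      next
        case False
        then have "2 * l - n \<le> l" "2 * l - (2 * l - n) = n" using n by auto
        then show ?thesis using that symmetric_path_nth(2)[of "2 * l - n" l u]
          by (auto simp: reflect_def split_beta)
      qed
    qed
  qed
  also have "\<dots> \<longleftrightarrow> (\<forall>n\<le>l. 2 * u n \<le> n)" by (auto simp: half_vertex_def)
  finally show ?thesis .
qed

lemma sum_gap:
  assumes "\<And>a. 1 \<le> a \<Longrightarrow> a \<le> i \<Longrightarrow> u (a - 1) n \<le> u a n" "u 0 n = 0"
  shows "(\<Sum>a = 1..i. gap k u a n) = u i n"
  using assms
proof (induction i)
  case (Suc i)
  have "(\<Sum>a = 1..i. gap k u a n) = u i n" using Suc by auto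
  then show ?case using Suc.prems(1)[of "Suc i"] by (simp add: gap_def)
qed simp

text \<open>
  Since the gaps below \<open>p\<^sub>i\<^sub>-\<^sub>1\<close> add up to \<open>u (i - 1) n\<close>, the second bound in the admissibility
  condition says \<open>u i n + u 1 n \<le> n\<close>. It is strongest for \<open>i = k - 1\<close>, where it is the comparison of
  the first gap with the zeroth. For \<open>k = 2\<close> there is no such bound, and the condition that \<open>p\<^sub>1\<close> stays
  below the line \<open>y = x - l\<close> gives \<open>2 * u 1 n \<le> n\<close>, which is the same comparison. So all bounds
  together say that the gaps decrease weakly in \<open>i\<close>, starting from \<open>i = 0\<close>. Moving the color
  \<open>j\<close> one step towards \<open>0\<close> raises \<open>n = l - \<bar>j\<bar>\<close> by one, so what remains is monotonicity in \<open>n\<close>.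
\<close>

lemma admissible_symmetric_paths_iff:
  assumes k: "2 \<le> k" and u: "\<And>i. i < k \<Longrightarrow> unit_steps l (u i)" and u0: "\<And>n. u 0 n = 0"
  shows "admissible l k (symmetric_paths l k u) \<longleftrightarrow>
    (\<forall>i n. 2 \<le> i \<and> i < k \<and> n \<le> l \<longrightarrow> u (i - 1) n \<le> u i n) \<and>
    (\<forall>i n. 1 \<le> i \<and> i < k \<and> n \<le> l \<longrightarrow> gap k u i n \<le> gap k u (i - 1) n) \<and>
    (\<forall>i n. 2 \<le> i \<and> i < k \<and> n < l \<longrightarrow> gap k u i n \<le> gap k u i (Suc n))"
    (is "?A \<longleftrightarrow> ?chain \<and> ?dom \<and> ?mono")
proof -
  let ?ps = "symmetric_paths l k u"
  let ?m = "\<lambda>j. nat (int l - \<bar>j\<bar>)"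
  have zero: "u i 0 = 0" if "i < k" for i using u[OF that] by (simp add: unit_steps_def)
  have gap0: "gap k u i 0 = 0" if "i < k" for i
    using that zero[of i] zero[of "i - 1"] by (simp add: gap_def)
  have chain: "path_chain l k ?ps \<longleftrightarrow> ?chain"
  proof -
    have "length ?ps = k - 1" by (simp add: symmetric_paths_def)
    moreover have "\<forall>p \<in> set ?ps. lattice_path l p"
      using u by (auto simp: symmetric_paths_def intro!: lattice_path_symmetric_path)
    moreover have "path_le l (nth1 ?ps (i - 1)) (nth1 ?ps i) \<longleftrightarrow> (\<forall>n\<le>l. u (i - 1) n \<le> u i n)"
      if "i \<in> {2..k - 1}" for i
    proof -
      have i: "1 \<le> i - 1" "i - 1 < k" "1 \<le> i" "i < k" using that k by auto
      show ?thesis unfolding nth1_symmetric_paths[OF i(1,2)] nth1_symmetric_paths[OF i(3,4)]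
        by (rule path_le_symmetric_path_iff[OF u[OF i(2)] u[OF i(4)]])
    qed
    ultimately have "path_chain l k ?ps \<longleftrightarrow> (\<forall>i\<in>{2..k - 1}. \<forall>n\<le>l. u (i - 1) n \<le> u i n)"
      by (simp add: path_chain_def)
    also have "\<dots> \<longleftrightarrow> ?chain" using k by auto
    finally show ?thesis .
  qed
  show ?thesis
  proof (cases ?chain)
    case False
    then show ?thesis using chain unfolding admissible_def by blast
  next
    case True
    have mono: "u (a - 1) n \<le> u a n" if "1 \<le> a" "a < k" "n \<le> l" for a n
      using True that u0 by (cases "a = 1") auto
    have sum: "(\<Sum>a = 1..i. gap k u a n) = u i n" if "i < k" "n \<le> l" for i n
      using that u0 by (intro sum_gap mono) auto
    have gap_sum: "gap k u i n + u (i - 1) n = u i n" if "1 \<le> i" "i < k" "n \<le> l" for i n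
      using mono[OF that] that by (simp add: gap_def)
    have u_le: "u i n \<le> n" if "i < k" "n \<le> l" for i n
      using unit_steps_le[OF u[OF that(1)] that(2)] .
    have diag: "(\<forall>(x, y) \<in> set (nth1 ?ps 1). y \<le> x - int l) \<longleftrightarrow> (\<forall>n\<le>l. 2 * u 1 n \<le> n)"
      using k below_diagonal_symmetric_path_iff[of l "u 1"] nth1_symmetric_paths[of 1 k l u] by simp
    let ?P = "\<lambda>i j. int (tnum l ?ps i j) \<le>
          min (int (tnum l ?ps (i - 1) j))
              (int l - \<bar>j\<bar> - int (tnum l ?ps 1 j) - (\<Sum>a = 1..i - 1. int (tnum l ?ps a j))) \<and>
        (j > 0 \<longrightarrow> tnum l ?ps i j \<le> tnum l ?ps i (j - 1)) \<and>
        (j < 0 \<longrightarrow> tnum l ?ps i j \<le> tnum l ?ps i (j + 1))"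
    let ?Q = "\<lambda>i j. gap k u i (?m j) \<le> gap k u (i - 1) (?m j) \<and> u i (?m j) + u 1 (?m j) \<le> ?m j \<and>
        (j \<noteq> 0 \<longrightarrow> gap k u i (?m j) \<le> gap k u i (Suc (?m j)))"
    have cond: "?P i j \<longleftrightarrow> ?Q i j"
      if i: "i \<in> {2..k - 1}" and j: "j \<in> {- (int l - 1)..int l - 1}" for i j
    proof -
      have t: "tnum l ?ps a j' = gap k u a (?m j')"
        if "a < k" "j' \<in> {- (int l - 1)..int l - 1}" for a j'
        by (rule tnum_symmetric_paths[where u = u]) (use k u u0 that in auto)
      have ik: "1 \<le> i" "i < k" "i - 1 < k" "1 < k" using i k by auto
      have ml: "?m j \<le> l" by simp
      have "(\<Sum>a = 1..i - 1. int (tnum l ?ps a j)) = (\<Sum>a = 1..i - 1. int (gap k u a (?m j)))"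
        using ik j by (intro sum.cong) (auto simp: t)
      also have "\<dots> = int (u (i - 1) (?m j))"
        using sum[OF ik(3) ml] by (metis of_nat_sum)
      finally have S: "(\<Sum>a = 1..i - 1. int (tnum l ?ps a j)) = int (u (i - 1) (?m j))" .
      have t1: "tnum l ?ps 1 j = u 1 (?m j)" using t[OF ik(4) j] u0 by (simp add: gap_def)
      define N where "N = ?m j"
      have m: "int l - \<bar>j\<bar> = int N" and Nl: "N \<le> l" using j by (auto simp: N_def)
      have "int (tnum l ?ps i j) \<le> min (int (tnum l ?ps (i - 1) j))
              (int l - \<bar>j\<bar> - int (tnum l ?ps 1 j) - (\<Sum>a = 1..i - 1. int (tnum l ?ps a j))) \<longleftrightarrow>
          gap k u i (?m j) \<le> gap k u (i - 1) (?m j) \<and> u i (?m j) + u 1 (?m j) \<le> ?m j"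
        unfolding S t[OF ik(2) j] t[OF ik(3) j] t1 min.bounded_iff
        unfolding m nat_int
        using gap_sum[OF ik(1,2) Nl] by linarith
      moreover have "tnum l ?ps i j = gap k u i (?m j)" by (rule t[OF ik(2) j])
      moreover have "tnum l ?ps i (j - 1) = gap k u i (Suc (?m j))" if "j > 0"
      proof -
        have "Suc (?m j) = ?m (j - 1)" using that j by auto
        then show ?thesis using t[OF ik(2), of "j - 1"] j that by simp
      qed
      moreover have "tnum l ?ps i (j + 1) = gap k u i (Suc (?m j))" if "j < 0"
      proof -
        have "Suc (?m j) = ?m (j + 1)" using that j by auto
        then show ?thesis using t[OF ik(2), of "j + 1"] j that by simp
      qed
      ultimately show ?thesis using linorder_neq_iff[of j 0] by metis
    qed
    have all: "(\<forall>i\<in>{2..k - 1}. \<forall>j\<in>{- (int l - 1)..int l - 1}. ?P i j) \<longleftrightarrow>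
      (\<forall>i\<in>{2..k - 1}. \<forall>j\<in>{- (int l - 1)..int l - 1}. ?Q i j)"
      by (intro ball_cong refl cond)
    have "?A \<longleftrightarrow> (\<forall>n\<le>l. 2 * u 1 n \<le> n) \<and>
      (\<forall>i\<in>{2..k - 1}. \<forall>j\<in>{- (int l - 1)..int l - 1}.
        gap k u i (?m j) \<le> gap k u (i - 1) (?m j) \<and> u i (?m j) + u 1 (?m j) \<le> ?m j \<and>
        (j \<noteq> 0 \<longrightarrow> gap k u i (?m j) \<le> gap k u i (Suc (?m j))))"
      unfolding admissible_def diag all using chain True by blast
    also have "\<dots> \<longleftrightarrow> (\<forall>n\<le>l. 2 * u 1 n \<le> n) \<and>
      (\<forall>i\<in>{2..k - 1}. \<forall>n\<le>l.
        gap k u i n \<le> gap k u (i - 1) n \<and> u i n + u 1 n \<le> n \<and>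
        (n < l \<longrightarrow> gap k u i n \<le> gap k u i (Suc n)))" (is "?D \<and> ?J \<longleftrightarrow> ?D \<and> ?N")
    proof -
      \<comment> \<open>Colors \<open>j\<close> and \<open>- j\<close> give the same condition; \<open>n = 0\<close> belongs to no color and is trivial.\<close>
      have "?J \<longleftrightarrow> ?N"
      proof (intro ball_cong refl iffI allI impI ballI)
        fix i n assume i: "i \<in> {2..k - 1}" and n: "n \<le> l"
          and J: "\<forall>j\<in>{- (int l - 1)..int l - 1}.
            gap k u i (?m j) \<le> gap k u (i - 1) (?m j) \<and> u i (?m j) + u 1 (?m j) \<le> ?m j \<and>
            (j \<noteq> 0 \<longrightarrow> gap k u i (?m j) \<le> gap k u i (Suc (?m j)))"
        have ik: "i < k" "i - 1 < k" "1 < k" using i k by auto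
        show "gap k u i n \<le> gap k u (i - 1) n \<and> u i n + u 1 n \<le> n \<and>
          (n < l \<longrightarrow> gap k u i n \<le> gap k u i (Suc n))"
        proof (cases "n = 0")
          case True
          then show ?thesis using gap0[OF ik(1)] gap0[OF ik(2)] zero[OF ik(1)] zero[OF ik(3)] by simp
        next
          case False
          have "?m (int l - int n) = n" using n by simp
          then show ?thesis using J[rule_format, of "int l - int n"] False n by auto
        qed
      next
        fix i j assume i: "i \<in> {2..k - 1}" and j: "j \<in> {- (int l - 1)..int l - 1}"
          and N: "\<forall>n\<le>l. gap k u i n \<le> gap k u (i - 1) n \<and> u i n + u 1 n \<le> n \<and>
            (n < l \<longrightarrow> gap k u i n \<le> gap k u i (Suc n))"
        show "gap k u i (?m j) \<le> gap k u (i - 1) (?m j) \<and> u i (?m j) + u 1 (?m j) \<le> ?m j \<and>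
            (j \<noteq> 0 \<longrightarrow> gap k u i (?m j) \<le> gap k u i (Suc (?m j)))"
          using N[rule_format, of "?m j"] j by auto
      qed
      then show ?thesis by simp
    qed
    also have "\<dots> \<longleftrightarrow> ?dom \<and> ?mono"
    proof
      assume L: "?D \<and> ?N"
      have "gap k u i n \<le> gap k u (i - 1) n" if i: "1 \<le> i" "i < k" and n: "n \<le> l" for i n
      proof (cases "i = 1")
        case False
        then show ?thesis using L that by auto
      next
        case True
        have "u (k - 1) n + u 1 n \<le> n"
        proof (cases "k = 2")
          case True
          then show ?thesis using L n by (simp add: mult_2)
        next
          case False
          then show ?thesis using L n k by auto
        qed
        then show ?thesis using True u0 by (simp add: gap_def)
      qed
      then show "?dom \<and> ?mono" using L by auto
    next
      assume R: "?dom \<and> ?mono"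
      have le_last: "u i n \<le> u (k - 1) n" if "i < k" "n \<le> l" for i n
      proof -
        have "i \<le> k - 1" using that by simp
        then show ?thesis
        proof (induction rule: inc_induct)
          case (step m)
          then have "Suc m < k" by linarith
          then show ?case using step mono[of "Suc m" n] that(2) by simp
        qed simp
      qed
      have "u (k - 1) n + u 1 n \<le> n" if n: "n \<le> l" for n
      proof -
        have "gap k u 1 n \<le> gap k u 0 n"
          using conjunct1[OF R, rule_format, of 1 n] k n by simp
        then show ?thesis using u0 u_le[of "k - 1" n] k n by (simp add: gap_def)
      qed
      then have *: "u i n + u 1 n \<le> n" if "i < k" "n \<le> l" for i n
        using le_last[OF that] that(2) by (meson add_le_mono1 order_trans)
      have ?D using *[of 1] k by (simp add: mult_2)
      moreover have ?N using R * by auto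
      ultimately show "?D \<and> ?N" by blast
    qed
    finally show ?thesis using True by blast
  qed
qed

section \<open>Ballot words and admissible sequences\<close>

definition prefix_count :: "nat list \<Rightarrow> nat set \<Rightarrow> nat \<Rightarrow> nat" where
  "prefix_count w A n = length (filter (\<lambda>r. r \<in> A) (take n w))"

text \<open>
  Words with \<open>l\<close> letters below \<open>k\<close> in which every prefix contains the letter \<open>r\<close> at least as
  often as \<open>r + 1\<close> (also called lattice words or Yamanouchi words). Letter \<open>0\<close> stands for a right
  move of all paths, letter \<open>r > 0\<close> for an up move of exactly the paths \<open>p\<^sub>r, \<dots>, p\<^sub>k\<^sub>-\<^sub>1\<close>.
\<close>

definition ballot_words :: "nat \<Rightarrow> nat \<Rightarrow> nat list set" where
  "ballot_words l k = {w. length w = l \<and> set w \<subseteq> {..<k} \<and>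
     (\<forall>r n. prefix_count w {Suc r} n \<le> prefix_count w {r} n)}"

definition paths_of_word :: "nat \<Rightarrow> nat \<Rightarrow> nat list \<Rightarrow> path list" where
  "paths_of_word l k w = symmetric_paths l k (\<lambda>i. prefix_count w {1..i})"

lemma prefix_count_0 [simp]: "prefix_count w A 0 = 0"
  by (simp add: prefix_count_def)

lemma prefix_count_Suc:
  "n < length w \<Longrightarrow> prefix_count w A (Suc n) = prefix_count w A n + (if w ! n \<in> A then 1 else 0)"
  by (simp add: prefix_count_def take_Suc_conv_app_nth)

lemma prefix_count_min: "prefix_count w A (min n (length w)) = prefix_count w A n"
  by (cases "n \<le> length w") (simp_all add: prefix_count_def min_def)

lemma unit_steps_prefix_count: "length w = l \<Longrightarrow> unit_steps l (prefix_count w A)"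
  by (auto simp: unit_steps_def prefix_count_Suc)

lemma prefix_count_empty_eq_0: "set w \<inter> A = {} \<Longrightarrow> prefix_count w A n = 0"
  by (auto simp: prefix_count_def filter_empty_conv dest: in_set_takeD)

lemma prefix_count_all: "set w \<subseteq> A \<Longrightarrow> n \<le> length w \<Longrightarrow> prefix_count w A n = n"
proof -
  assume "set w \<subseteq> A" "n \<le> length w"
  then have "filter (\<lambda>r. r \<in> A) (take n w) = take n w"
    by (auto simp: filter_id_conv dest: in_set_takeD)
  then show ?thesis using \<open>n \<le> length w\<close> by (simp add: prefix_count_def)
qed

lemma prefix_count_Un_disjoint:
  assumes "A \<inter> B = {}"
  shows "prefix_count w (A \<union> B) n = prefix_count w A n + prefix_count w B n"
proof -
  have "length (filter (\<lambda>r. r \<in> A \<union> B) xs) =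
      length (filter (\<lambda>r. r \<in> A) xs) + length (filter (\<lambda>r. r \<in> B) xs)" for xs
    using assms by (induction xs) auto
  then show ?thesis by (simp add: prefix_count_def)
qed

text \<open>
  An up move of \<open>p\<^sub>i\<close> but not of \<open>p\<^sub>i\<^sub>-\<^sub>1\<close> is a letter \<open>i\<close>, and a right move of \<open>p\<^sub>k\<^sub>-\<^sub>1\<close> is a letter
  \<open>0\<close>: the gaps count the letters of a prefix.
\<close>

lemma gap_prefix_count:
  assumes w: "set w \<subseteq> {..<k}" and i: "i < k" and n: "n \<le> length w"
  shows "gap k (\<lambda>i. prefix_count w {1..i}) i n = prefix_count w {i} n"
proof (cases "i = 0")
  case True
  have "{..<k} = {0} \<union> {1..k - 1}" using i by auto
  then have "prefix_count w {0} n + prefix_count w {1..k - 1} n = n"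
    using prefix_count_all[OF w n] prefix_count_Un_disjoint[of "{0}" "{1..k - 1}" w n] by simp
  then show ?thesis using True by (simp add: gap_def)
next
  case False
  then have "{1..i} = {1..i - 1} \<union> {i}" by auto
  then have "prefix_count w {1..i} n = prefix_count w {1..i - 1} n + prefix_count w {i} n"
    using prefix_count_Un_disjoint[of "{1..i - 1}" "{i}" w n] False by simp
  then show ?thesis using False by (simp add: gap_def)
qed

lemma tnum_paths_of_word:
  assumes "2 \<le> k" "length w = l" "set w \<subseteq> {..<k}" "i < k" "j \<in> {- (int l - 1)..int l - 1}"
  shows "tnum l (paths_of_word l k w) i j = prefix_count w {i} (nat (int l - \<bar>j\<bar>))"
proof -
  have "tnum l (paths_of_word l k w) i j =
      gap k (\<lambda>i. prefix_count w {1..i}) i (nat (int l - \<bar>j\<bar>))"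
    unfolding paths_of_word_def using assms
    by (intro tnum_symmetric_paths unit_steps_prefix_count)
      (auto intro: prefix_count_empty_eq_0)
  also have "\<dots> = prefix_count w {i} (nat (int l - \<bar>j\<bar>))"
    using assms by (intro gap_prefix_count) auto
  finally show ?thesis .
qed

lemma paths_of_ballot_word_admissible:
  assumes k: "2 \<le> k" and w: "w \<in> ballot_words l k"
  shows "paths_of_word l k w \<in> SC_admissible l k"
proof -
  have len: "length w = l" and sub: "set w \<subseteq> {..<k}"
    and ballot: "\<And>r n. prefix_count w {Suc r} n \<le> prefix_count w {r} n"
    using w by (auto simp: ballot_words_def)
  let ?u = "\<lambda>i. prefix_count w {1..i}"
  have "admissible l k (symmetric_paths l k ?u)"
  proof (subst admissible_symmetric_paths_iff[OF k])
    show "unit_steps l (?u i)" for i using len by (rule unit_steps_prefix_count)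
    show "?u 0 n = 0" for n by (simp add: prefix_count_empty_eq_0)
    have "?u (i - 1) n \<le> ?u i n" if "2 \<le> i" for i n
    proof -
      have "{1..i} = {1..i - 1} \<union> {i}" using that by auto
      then show ?thesis using prefix_count_Un_disjoint[of "{1..i - 1}" "{i}" w n] that by simp
    qed
    moreover have "gap k ?u i n \<le> gap k ?u (i - 1) n" if "1 \<le> i" "i < k" "n \<le> l" for i n
    proof -
      have "gap k ?u i n = prefix_count w {i} n" "gap k ?u (i - 1) n = prefix_count w {i - 1} n"
        using that len gap_prefix_count[OF sub, of i n] gap_prefix_count[OF sub, of "i - 1" n] by auto
      then show ?thesis using ballot[of "i - 1" n] that by simp
    qed
    moreover have "gap k ?u i n \<le> gap k ?u i (Suc n)" if "i < k" "n < l" for i n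
      using that len gap_prefix_count[OF sub, of i n] gap_prefix_count[OF sub, of i "Suc n"]
      by (simp add: prefix_count_Suc)
    ultimately show "(\<forall>i n. 2 \<le> i \<and> i < k \<and> n \<le> l \<longrightarrow> ?u (i - 1) n \<le> ?u i n) \<and>
      (\<forall>i n. 1 \<le> i \<and> i < k \<and> n \<le> l \<longrightarrow> gap k ?u i n \<le> gap k ?u (i - 1) n) \<and>
      (\<forall>i n. 2 \<le> i \<and> i < k \<and> n < l \<longrightarrow> gap k ?u i n \<le> gap k ?u i (Suc n))"
      by blast
  qed
  moreover have "\<forall>p \<in> set (symmetric_paths l k ?u). self_conjugate p"
    by (auto simp: symmetric_paths_def self_conjugate_symmetric_path)
  ultimately show ?thesis by (simp add: SC_admissible_def paths_of_word_def)
qed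

lemma symmetric_path_cong:
  assumes "\<And>n. n \<le> l \<Longrightarrow> u n = v n"
  shows "symmetric_path l u = symmetric_path l v"
  using assms by (auto simp: symmetric_path_def half_vertex_def simp del: upt_Suc)

lemma SC_admissible_obtain_symmetric_paths:
  assumes "ps \<in> SC_admissible l k"
  obtains u where "ps = symmetric_paths l k u" "\<And>n. u 0 n = 0" "\<And>i. i < k \<Longrightarrow> unit_steps l (u i)"
proof -
  have len: "length ps = k - 1" and p: "\<And>p. p \<in> set ps \<Longrightarrow> lattice_path l p \<and> self_conjugate p"
    using assms by (auto simp: SC_admissible_def admissible_def path_chain_def)
  have "\<exists>u. unit_steps l u \<and> nth1 ps i = symmetric_path l u" if "i \<in> {1..<k}" for i
  proof -
    have "nth1 ps i \<in> set ps" using that len by (intro nth_mem) auto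
    then show ?thesis using p self_conjugate_path_eq_symmetric_path by metis
  qed
  then obtain v where v: "\<And>i. i \<in> {1..<k} \<Longrightarrow> unit_steps l (v i) \<and> nth1 ps i = symmetric_path l (v i)"
    by metis
  define u where "u i = (if i = 0 then (\<lambda>_. 0) else v i)" for i
  show thesis
  proof
    show "ps = symmetric_paths l k u"
    proof (rule nth_equalityI)
      show "length ps = length (symmetric_paths l k u)" by (simp add: len symmetric_paths_def)
      show "ps ! i = symmetric_paths l k u ! i" if "i < length ps" for i
        using nth1_symmetric_paths[of "Suc i" k l u] v[of "Suc i"] that len by (simp add: u_def)
    qed
    show "u 0 n = 0" for n by (simp add: u_def)
    show "unit_steps l (u i)" if "i < k" for i
      using v[of i] that by (auto simp: u_def unit_steps_def)
  qed
qed

text \<open>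
  The gaps with \<open>i \<ge> 2\<close> never shrink as \<open>n\<close> grows. So if \<open>p\<^sub>i\<close> moves up, the path above it must move
  up as well: at each time the paths that move up are \<open>p\<^sub>r, \<dots>, p\<^sub>k\<^sub>-\<^sub>1\<close> for some \<open>r\<close>, or none of them,
  and this is the letter of the word.
\<close>

lemma SC_admissible_obtain_ballot_word:
  assumes k: "2 \<le> k" and ps: "ps \<in> SC_admissible l k"
  obtains w where "w \<in> ballot_words l k" "ps = paths_of_word l k w"
proof -
  obtain u where psu: "ps = symmetric_paths l k u" and u0: "\<And>n. u 0 n = 0"
    and u: "\<And>i. i < k \<Longrightarrow> unit_steps l (u i)"
    using SC_admissible_obtain_symmetric_paths[OF ps] by metis
  have "admissible l k (symmetric_paths l k u)" using ps psu by (simp add: SC_admissible_def)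
  then have chain: "\<And>i n. 2 \<le> i \<Longrightarrow> i < k \<Longrightarrow> n \<le> l \<Longrightarrow> u (i - 1) n \<le> u i n"
    and dom: "\<And>i n. 1 \<le> i \<Longrightarrow> i < k \<Longrightarrow> n \<le> l \<Longrightarrow> gap k u i n \<le> gap k u (i - 1) n"
    and mono: "\<And>i n. 2 \<le> i \<Longrightarrow> i < k \<Longrightarrow> n < l \<Longrightarrow> gap k u i n \<le> gap k u i (Suc n)"
    using admissible_symmetric_paths_iff[of k l u, OF k u u0] by blast+
  define up where "up i n \<longleftrightarrow> 1 \<le> i \<and> i < k \<and> u i (Suc n) = Suc (u i n)" for i n
  have step: "u i (Suc n) = (if up i n then Suc (u i n) else u i n)" if "i < k" "n < l" for i n
    using u[OF that(1)] u0 that by (cases "i = 0") (auto simp: up_def unit_steps_def)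
  have up_Suc: "up (Suc i) n" if "up i n" "Suc i < k" "n < l" for i n
  proof -
    have "2 \<le> Suc i" using that(1) by (auto simp: up_def)
    then have "u (Suc i) n - u i n \<le> u (Suc i) (Suc n) - u i (Suc n)"
      "u i n \<le> u (Suc i) n" "u i (Suc n) \<le> u (Suc i) (Suc n)"
      using mono[of "Suc i" n] chain[of "Suc i" n] chain[of "Suc i" "Suc n"] that
      by (auto simp: gap_def)
    moreover have "u i (Suc n) = Suc (u i n)" using that(1) by (simp add: up_def)
    ultimately have "u (Suc i) n < u (Suc i) (Suc n)" by linarith
    then show ?thesis using step[OF that(2,3)] by (auto split: if_splits)
  qed
  have up_mono: "up i' n" if "up i n" "i \<le> i'" "i' < k" "n < l" for i i' n
    using that(2,3)
  proof (induction rule: dec_induct)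
    case (step m)
    then show ?case using up_Suc[of m n] that(4) by simp
  qed (use that in simp)
  define w where "w = map (\<lambda>n. if \<exists>i. up i n then LEAST i. up i n else 0) [0..<l]"
  have len: "length w = l" by (simp add: w_def)
  have wn: "w ! n = (if \<exists>i. up i n then LEAST i. up i n else 0)" if "n < l" for n
    using that by (simp add: w_def)
  have sub: "set w \<subseteq> {..<k}"
  proof
    fix r assume "r \<in> set w"
    then obtain n where n: "n < l" "r = w ! n" using len by (auto simp: in_set_conv_nth)
    show "r \<in> {..<k}"
    proof (cases "\<exists>i. up i n")
      case True
      then have "up (LEAST i. up i n) n" by (rule LeastI_ex)
      then have "up r n" using n wn True by simp
      then show ?thesis by (simp add: up_def)
    qed (use n wn k in simp)
  qed
  have up_iff: "up i n \<longleftrightarrow> w ! n \<in> {1..i}" if "i < k" "n < l" for i n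
  proof
    assume "up i n"
    then have "up (LEAST i. up i n) n" "(LEAST i. up i n) \<le> i" by (auto intro: LeastI Least_le)
    moreover have "w ! n = (LEAST i. up i n)" using wn[OF that(2)] \<open>up i n\<close> by auto
    ultimately show "w ! n \<in> {1..i}" by (auto simp: up_def)
  next
    assume *: "w ! n \<in> {1..i}"
    then have ex: "\<exists>i. up i n" using wn[OF that(2)] by (auto split: if_splits)
    then have "up (LEAST i. up i n) n" by (rule LeastI_ex)
    then have "up (w ! n) n" using wn[OF that(2)] ex by simp
    then show "up i n" using up_mono * that by auto
  qed
  have eq: "prefix_count w {1..i} n = u i n" if "i < k" "n \<le> l" for i n
    using that(2)
  proof (induction n)
    case 0
    then show ?case using u[OF that(1)] by (simp add: unit_steps_def)
  next
    case (Suc n)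
    then show ?case using step[OF that(1), of n] up_iff[OF that(1), of n] len
      by (simp add: prefix_count_Suc)
  qed
  have gap: "prefix_count w {i} n = gap k u i n" if "i < k" "n \<le> l" for i n
  proof -
    have "prefix_count w {i} n = gap k (\<lambda>i. prefix_count w {1..i}) i n"
      using gap_prefix_count[OF sub that(1)] that(2) len by simp
    also have "\<dots> = gap k u i n"
      using eq[of i n] eq[of "i - 1" n] eq[of "k - 1" n] that by (simp add: gap_def)
    finally show ?thesis .
  qed
  show thesis
  proof
    have "prefix_count w {Suc r} n \<le> prefix_count w {r} n" for r n
    proof (cases "Suc r < k")
      case True
      have "prefix_count w {Suc r} (min n l) \<le> prefix_count w {r} (min n l)"
        using dom[of "Suc r" "min n l"] True by (simp add: gap)
      then show ?thesis using prefix_count_min len by metis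
    next
      case False
      then show ?thesis using sub by (subst prefix_count_empty_eq_0) auto
    qed
    then show "w \<in> ballot_words l k" using len sub by (simp add: ballot_words_def)
    show "ps = paths_of_word l k w"
      unfolding psu paths_of_word_def symmetric_paths_def using eq
      by (auto intro!: symmetric_path_cong)
  qed
qed

text \<open>
  The letter at position \<open>n\<close> is the one whose count increases from the prefix of length \<open>n\<close> to the
  next.
\<close>

lemma word_eqI_prefix_count:
  assumes "length w = length w'" "set w \<subseteq> {..<k}"
    and eq: "\<And>i n. i < k \<Longrightarrow> n \<le> length w \<Longrightarrow> prefix_count w {i} n = prefix_count w' {i} n"
  shows "w = w'"
proof (rule nth_equalityI)
  fix n assume n: "n < length w"
  then have "w ! n < k" using assms(2) nth_mem by blast
  then show "w ! n = w' ! n"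
    using eq[of "w ! n" n] eq[of "w ! n" "Suc n"] n assms(1)
    by (auto simp: prefix_count_Suc split: if_splits)
qed (fact assms(1))

lemma bij_betw_paths_of_word:
  assumes k: "2 \<le> k"
  shows "bij_betw (paths_of_word l k) (ballot_words l k) (SC_admissible l k)"
  unfolding bij_betw_def
proof
  show "inj_on (paths_of_word l k) (ballot_words l k)"
  proof (rule inj_onI)
    fix w w' assume w: "w \<in> ballot_words l k" and w': "w' \<in> ballot_words l k"
      and eq: "paths_of_word l k w = paths_of_word l k w'"
    have len: "length w = l" "length w' = l" and sub: "set w \<subseteq> {..<k}" "set w' \<subseteq> {..<k}"
      using w w' by (auto simp: ballot_words_def)
    show "w = w'"
    proof (rule word_eqI_prefix_count)
      fix i n assume i: "i < k" and n: "n \<le> length w"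
      show "prefix_count w {i} n = prefix_count w' {i} n"
      proof (cases "n = 0")
        case False
        then have j: "int l - int n \<in> {- (int l - 1)..int l - 1}" using n len by auto
        have "nat (int l - \<bar>int l - int n\<bar>) = n" using n len by simp
        then show ?thesis
          using tnum_paths_of_word[OF k len(1) sub(1) i j] tnum_paths_of_word[OF k len(2) sub(2) i j] eq
          by simp
      qed simp
    qed (use len sub in auto)
  qed
  show "paths_of_word l k ` ballot_words l k = SC_admissible l k"
    using paths_of_ballot_word_admissible[OF k] SC_admissible_obtain_ballot_word[OF k] by blast
qed

section \<open>Ballot words and standard tableaux\<close>

lemma distinct_concat_row_unique:
  assumes "distinct (concat X)" "r < length X" "x \<in> set (X ! r)" "s < length X" "x \<in> set (X ! s)"
  shows "r = s"
proof -
  have "\<not> r < s" if rs: "distinct (concat X)" "s < length X" "x \<in> set (X ! r)" "x \<in> set (X ! s)" for r s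
  proof
    assume "r < s"
    then have "X = take r X @ X ! r # drop (Suc r) X" using rs(2) by (simp add: id_take_nth_drop)
    then have "concat X = concat (take r X) @ X ! r @ concat (drop (Suc r) X)"
      by (metis concat.simps(2) concat_append)
    then have "set (X ! r) \<inter> set (concat (drop (Suc r) X)) = {}" using rs(1) by auto
    moreover have "X ! s \<in> set (drop (Suc r) X)"
      using \<open>r < s\<close> rs(2) by (auto simp: in_set_conv_nth intro!: exI[of _ "s - Suc r"])
    ultimately show False using rs(3,4) by auto
  qed
  from this[of s r] this[of r s] show ?thesis using assms by (meson linorder_neqE_nat)
qed

lemma card_set_le_eq_card_index:
  assumes "distinct xs"
  shows "card {x \<in> set xs. x \<le> n} = card {c. c < length xs \<and> xs ! c \<le> (n :: 'a :: linorder)}"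
proof -
  have "{x \<in> set xs. x \<le> n} = (\<lambda>c. xs ! c) ` {c. c < length xs \<and> xs ! c \<le> n}"
    by (auto simp: in_set_conv_nth)
  moreover have "inj_on (\<lambda>c. xs ! c) {c. c < length xs \<and> xs ! c \<le> n}"
    using assms by (auto simp: inj_on_def nth_eq_iff_index_eq)
  ultimately show ?thesis by (simp add: card_image)
qed

text \<open>
  This is the reason why standard tableaux correspond to ballot words. The entry \<open>B ! c\<close> lies below an
  earlier entry of \<open>A\<close> precisely when, at the moment \<open>B ! c\<close> is inserted and \<open>B\<close> reaches length
  \<open>c + 1\<close>, the row \<open>A\<close> already has \<open>c + 1\<close> entries. Disjointness excludes equality in a column.
\<close>

lemma columns_increase_iff_counts_dominate:
  fixes A B :: "'a :: linorder list"
  assumes A: "sorted_wrt (<) A" and B: "sorted_wrt (<) B" and disj: "set A \<inter> set B = {}"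
  shows "(\<forall>c<length B. c < length A \<and> A ! c < B ! c) \<longleftrightarrow>
    (\<forall>n. card {x \<in> set B. x \<le> n} \<le> card {x \<in> set A. x \<le> n})"
proof -
  have "distinct A" "distinct B" using A B by (simp_all add: strict_sorted_iff)
  then have eq: "card {x \<in> set B. x \<le> n} \<le> card {x \<in> set A. x \<le> n} \<longleftrightarrow>
      card {c. c < length B \<and> B ! c \<le> n} \<le> card {c. c < length A \<and> A ! c \<le> n}" for n
    by (simp add: card_set_le_eq_card_index)
  show ?thesis unfolding eq
  proof
    assume *: "\<forall>c<length B. c < length A \<and> A ! c < B ! c"
    show "\<forall>n. card {c. c < length B \<and> B ! c \<le> n} \<le> card {c. c < length A \<and> A ! c \<le> n}"
      using * by (intro allI card_mono) (auto intro: order.trans less_imp_le)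
  next
    assume *: "\<forall>n. card {c. c < length B \<and> B ! c \<le> n} \<le> card {c. c < length A \<and> A ! c \<le> n}"
    show "\<forall>c<length B. c < length A \<and> A ! c < B ! c"
    proof (intro allI impI, rule ccontr)
      fix c assume c: "c < length B" and "\<not> (c < length A \<and> A ! c < B ! c)"
      then have not: "\<not> A ! c < B ! c" if "c < length A" using that by simp
      have "{c'. c' < length A \<and> A ! c' \<le> B ! c} \<subseteq> {..<c}"
      proof (rule subsetI, rule ccontr)
        fix c' assume c': "c' \<in> {c'. c' < length A \<and> A ! c' \<le> B ! c}" "c' \<notin> {..<c}"
        then have "c < length A" "A ! c \<le> A ! c'"
          using sorted_wrt_nth_less[OF A, of c c'] by (cases "c = c'"; force)+
        then have "A ! c \<le> B ! c" "A ! c \<in> set A" using c' by auto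
        moreover have "B ! c \<in> set B" using c by simp
        ultimately show False using disj not[OF \<open>c < length A\<close>] by (metis disjoint_iff order_le_less)
      qed
      then have "card {c'. c' < length A \<and> A ! c' \<le> B ! c} \<le> c"
        using card_mono[of "{..<c}"] by fastforce
      moreover have "{..c} \<subseteq> {c'. c' < length B \<and> B ! c' \<le> B ! c}"
        using sorted_wrt_nth_less[OF B, of _ c] c by (auto simp: order_le_less)
      then have "Suc c \<le> card {c'. c' < length B \<and> B ! c' \<le> B ! c}"
        using card_mono[of "{c'. c' < length B \<and> B ! c' \<le> B ! c}" "{..c}"] by simp
      ultimately show False using *[rule_format, of "B ! c"] by simp
    qed
  qed
qed

text \<open>
  Positions are counted from \<open>1\<close>, so that they are the entries of a row of a tableau.
\<close>

definition letter_positions :: "nat list \<Rightarrow> nat \<Rightarrow> nat list" where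
  "letter_positions w r = map Suc (filter (\<lambda>j. w ! j = r) [0..<length w])"

definition row_index :: "tableau \<Rightarrow> nat \<Rightarrow> nat" where
  "row_index X x = (THE r. r < length X \<and> x \<in> set (X ! r))"

text \<open>
  The word whose letter positions are the rows of the tableau. Its index \<open>j\<close>, counted from \<open>0\<close>, belongs
  to the entry \<open>j + 1\<close>.
\<close>

definition row_word :: "tableau \<Rightarrow> nat list" where
  "row_word X = map (row_index X) [1..<Suc (length (concat X))]"

lemma set_letter_positions: "set (letter_positions w r) = Suc ` {j. j < length w \<and> w ! j = r}"
  by (auto simp: letter_positions_def)

lemma Suc_mem_letter_positions_iff:
  "Suc j \<in> set (letter_positions w r) \<longleftrightarrow> j < length w \<and> w ! j = r"
  by (auto simp: set_letter_positions)

lemma sorted_letter_positions: "sorted_wrt (<) (letter_positions w r)"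
proof -
  have "sorted_wrt (<) (filter (\<lambda>j. w ! j = r) [0..<length w])"
    by (intro sorted_wrt_filter sorted_wrt_upt)
  then show ?thesis by (simp add: letter_positions_def sorted_wrt_map)
qed

lemma card_letter_positions_le:
  "card {x \<in> set (letter_positions w r). x \<le> n} = prefix_count w {r} n"
proof -
  have "{x \<in> set (letter_positions w r). x \<le> n} = Suc ` {j. j < length (take n w) \<and> take n w ! j \<in> {r}}"
    by (auto simp: set_letter_positions)
  then show ?thesis unfolding prefix_count_def length_filter_conv_card by (simp add: card_image)
qed

lemma length_letter_positions: "length (letter_positions w r) = prefix_count w {r} (length w)"
proof -
  have "length (letter_positions w r) = card (set (letter_positions w r))"
    using sorted_letter_positions[of w r] by (simp add: strict_sorted_iff distinct_card)
  also have "set (letter_positions w r) = {x \<in> set (letter_positions w r). x \<le> length w}"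
    by (auto simp: set_letter_positions)
  finally show ?thesis by (simp add: card_letter_positions_le)
qed

lemma letter_positions_columns_iff:
  assumes "r \<noteq> s"
  shows "(\<forall>c<length (letter_positions w s).
      c < length (letter_positions w r) \<and> letter_positions w r ! c < letter_positions w s ! c) \<longleftrightarrow>
    (\<forall>n. prefix_count w {s} n \<le> prefix_count w {r} n)"
proof -
  have "set (letter_positions w r) \<inter> set (letter_positions w s) = {}"
    using assms by (auto simp: set_letter_positions)
  from columns_increase_iff_counts_dominate[OF sorted_letter_positions sorted_letter_positions this]
  show ?thesis by (simp add: card_letter_positions_le)
qed

lemma length_row_word [simp]: "length (row_word X) = length (concat X)"
  by (simp add: row_word_def del: upt_Suc length_concat)

lemma mem_row_iff:
  assumes X: "standard_tableau X" and j: "j < length (concat X)"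
  shows "r < length X \<and> Suc j \<in> set (X ! r) \<longleftrightarrow> row_word X ! j = r"
proof -
  have d: "distinct (concat X)" and s: "set (concat X) = {1..length (concat X)}"
    using X by (auto simp: standard_tableau_def)
  have "Suc j \<in> set (concat X)" unfolding s using j by simp
  then obtain R where "R \<in> set X" "Suc j \<in> set R" by auto
  then obtain q where q: "q < length X" "Suc j \<in> set (X ! q)"
    by (metis in_set_conv_nth)
  have uniq: "r = q" if "r < length X \<and> Suc j \<in> set (X ! r)" for r
    using distinct_concat_row_unique[OF d, of r "Suc j" q] that q by simp
  have "row_index X (Suc j) = q"
    unfolding row_index_def by (rule the_equality) (use q uniq in blast)+
  moreover have "row_word X ! j = row_index X (Suc j)"
    using j by (simp add: row_word_def del: upt_Suc)
  ultimately show ?thesis using q uniq by metis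
qed

lemma row_eq_letter_positions:
  assumes X: "standard_tableau X" and r: "r < length X"
  shows "X ! r = letter_positions (row_word X) r"
proof (rule strict_sorted_equal)
  show "sorted_wrt (<) (letter_positions (row_word X) r)" by (rule sorted_letter_positions)
  show "sorted_wrt (<) (X ! r)" using X r by (auto simp: standard_tableau_def)
  have sub: "set (X ! r) \<subseteq> {1..length (concat X)}"
  proof -
    have "set (X ! r) \<subseteq> set (concat X)" using nth_mem[OF r] by auto
    also have "\<dots> = {1..length (concat X)}" using X unfolding standard_tableau_def by blast
    finally show ?thesis .
  qed
  have mem: "Suc j \<in> set (X ! r) \<longleftrightarrow> Suc j \<in> set (letter_positions (row_word X) r)" for j
  proof (cases "j < length (concat X)")
    case True
    then show ?thesis unfolding Suc_mem_letter_positions_iff length_row_word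
      using mem_row_iff[OF X True, of r] r by blast
  next
    case False
    then have "Suc j \<notin> {1..length (concat X)}" by (simp del: length_concat)
    then have "Suc j \<notin> set (X ! r)" using sub by blast
    then show ?thesis unfolding Suc_mem_letter_positions_iff length_row_word using False by blast
  qed
  have "0 \<notin> {1..length (concat X)}" by (simp del: length_concat)
  then have "0 \<notin> set (X ! r)" using sub by blast
  moreover have "0 \<notin> set (letter_positions (row_word X) r)" by (simp add: letter_positions_def)
  ultimately have "x \<in> set (X ! r) \<longleftrightarrow> x \<in> set (letter_positions (row_word X) r)" for x
    by (cases x) (simp_all only: mem)
  then show "set (X ! r) = set (letter_positions (row_word X) r)" by blast
qed

lemma set_row_word:
  assumes X: "standard_tableau X"
  shows "set (row_word X) = {..<length X}"
proof
  show "set (row_word X) \<subseteq> {..<length X}"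
  proof
    fix r assume "r \<in> set (row_word X)"
    then obtain j where "j < length (concat X)" "row_word X ! j = r"
      by (metis in_set_conv_nth length_row_word)
    then show "r \<in> {..<length X}" using mem_row_iff[OF X, of j r] by simp
  qed
  show "{..<length X} \<subseteq> set (row_word X)"
  proof
    fix r assume r: "r \<in> {..<length X}"
    then have "X ! r \<in> set X" by simp
    moreover have "[] \<notin> set X" using X by (simp add: standard_tableau_def)
    ultimately have "X ! r \<noteq> []" by metis
    moreover have "X ! r = letter_positions (row_word X) r"
      using r by (intro row_eq_letter_positions[OF X]) simp
    ultimately have "letter_positions (row_word X) r \<noteq> []" by (simp only: not_False_eq_True)
    then obtain j where "Suc j \<in> set (letter_positions (row_word X) r)"
      by (fastforce simp: letter_positions_def filter_empty_conv)
    then show "r \<in> set (row_word X)"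
      unfolding Suc_mem_letter_positions_iff by (metis nth_mem)
  qed
qed

lemma tableau_eq_letter_positions:
  assumes X: "standard_tableau X"
  shows "X = map (letter_positions (row_word X)) [0..<length X]"
  by (rule nth_equalityI) (simp_all add: row_eq_letter_positions[OF X, symmetric])

lemma row_word_ballot:
  assumes "X \<in> SYT_max_rows l k"
  shows "row_word X \<in> ballot_words l k"
proof -
  let ?w = "row_word X"
  have X: "standard_tableau X" and l: "length (concat X) = l" and k: "length X \<le> k"
    using assms by (auto simp: SYT_max_rows_def)
  have "prefix_count ?w {Suc r} n \<le> prefix_count ?w {r} n" for r n
  proof (cases "Suc r < length X")
    case True
    have "length (X ! Suc r) \<le> length (X ! r)"
      using X True sorted_wrt_nth_less[of "(\<ge>)" "map length X" r "Suc r"]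
      by (simp add: standard_tableau_def)
    then have "\<forall>c<length (X ! Suc r). c < length (X ! r) \<and> X ! r ! c < X ! Suc r ! c"
      using X True by (auto simp: standard_tableau_def)
    moreover have rows: "letter_positions ?w r = X ! r" "letter_positions ?w (Suc r) = X ! Suc r"
      using True by (simp_all add: row_eq_letter_positions[OF X, symmetric])
    ultimately show ?thesis
      using letter_positions_columns_iff[of r "Suc r" ?w] unfolding rows by simp
  next
    case False
    then show ?thesis using set_row_word[OF X] by (subst prefix_count_empty_eq_0) auto
  qed
  then show ?thesis using l k set_row_word[OF X] by (auto simp: ballot_words_def)
qed

text \<open>
  By the ballot condition \<open>r + 1\<close> cannot occur without \<open>r\<close>, so the letters form an initial segment
  and the corresponding tableau has no empty row between nonempty ones.
\<close>

lemma ballot_word_letters: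
  assumes "w \<in> ballot_words l k"
  obtains m where "m \<le> k" "set w = {..<m}"
proof -
  have len: "length w = l" and sub: "set w \<subseteq> {..<k}"
    and ballot: "\<And>r n. prefix_count w {Suc r} n \<le> prefix_count w {r} n"
    using assms by (auto simp: ballot_words_def)
  have mem: "r \<in> set w \<longleftrightarrow> prefix_count w {r} l > 0" for r
    using len by (auto simp: prefix_count_def filter_empty_conv)
  have down: "r \<in> set w" if "Suc r \<in> set w" for r
    using that ballot[of r l] unfolding mem by linarith
  define m where "m = (LEAST r. r \<notin> set w)"
  have "k \<notin> set w" using sub by auto
  then have m: "m \<notin> set w" "m \<le> k" unfolding m_def by (rule LeastI, rule Least_le)
  have "r \<notin> set w" if "m \<le> r" for r
    using that by (induction rule: dec_induct) (use m down in auto)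
  moreover have "r \<in> set w" if "r < m" for r
    using not_less_Least[of r "\<lambda>r. r \<notin> set w"] that by (auto simp: m_def)
  ultimately have "set w = {..<m}" by (auto simp: not_le[symmetric])
  with m(2) show thesis by (rule that)
qed

lemma ballot_word_obtain_tableau:
  assumes w: "w \<in> ballot_words l k"
  obtains X where "X \<in> SYT_max_rows l k" "row_word X = w"
proof -
  have len: "length w = l"
    and ballot: "\<And>r n. prefix_count w {Suc r} n \<le> prefix_count w {r} n"
    using w by (auto simp: ballot_words_def)
  obtain m where m: "m \<le> k" "set w = {..<m}" using ballot_word_letters[OF w] .
  define X where "X = map (letter_positions w) [0..<m]"
  have lenX: "length X = m" and nthX: "\<And>r. r < m \<Longrightarrow> X ! r = letter_positions w r"
    by (simp_all add: X_def)
  have nonempty: "set (letter_positions w r) \<noteq> {}" if "r < m" for r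
  proof -
    have "r \<in> set w" using that m by simp
    then show ?thesis by (auto simp: set_letter_positions in_set_conv_nth)
  qed
  have disj: "set (letter_positions w r) \<inter> set (letter_positions w s) = {}" if "r \<noteq> s" for r s
    using that by (auto simp: set_letter_positions)
  have inj: "inj_on (letter_positions w) {..<m}"
    using nonempty disj by (metis (mono_tags, lifting) inf.idem inj_onI lessThan_iff)
  have dist: "distinct (concat X)"
  proof (rule distinct_concat)
    show "distinct X" using inj by (simp add: X_def distinct_map lessThan_atLeast0)
    show "distinct R" if "R \<in> set X" for R
      using that sorted_letter_positions strict_sorted_iff by (auto simp: X_def)
    show "set R \<inter> set S = {}" if RS: "R \<in> set X" "S \<in> set X" "R \<noteq> S" for R S
    proof -
      obtain r s where "R = letter_positions w r" "S = letter_positions w s"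
        using RS by (auto simp: X_def)
      then show ?thesis using disj[of r s] RS(3) by blast
    qed
  qed
  have setX: "set (concat X) = {1..l}"
  proof -
    have "set (concat X) = Suc ` {j. j < length w \<and> w ! j < m}"
      by (auto simp: X_def set_letter_positions)
    also have "{j. j < length w \<and> w ! j < m} = {..<l}" using m len nth_mem[of _ w] by auto
    also have "Suc ` {..<l} = {1..l}" by (auto simp: lessThan_atLeast0)
    finally show ?thesis .
  qed
  have lenc: "length (concat X) = l" using distinct_card[OF dist] setX by simp
  have cols: "\<forall>c<length (letter_positions w (Suc r)).
      c < length (letter_positions w r) \<and> letter_positions w r ! c < letter_positions w (Suc r) ! c" for r
    using letter_positions_columns_iff[of r "Suc r" w] ballot by simp
  have antitone: "length (letter_positions w s) \<le> length (letter_positions w r)" if "r \<le> s" for r s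
    unfolding length_letter_positions
    using lift_Suc_antimono_le[of "\<lambda>r. prefix_count w {r} (length w)" r s] ballot that by simp
  have std: "standard_tableau X"
    unfolding standard_tableau_def
  proof (intro conjI)
    show "[] \<notin> set X" using nonempty by (force simp: X_def)
    show "sorted_wrt (\<ge>) (map length X)"
      using antitone by (simp add: sorted_wrt_iff_nth_less lenX nthX)
    show "set (concat X) = {1..length (concat X)}" using setX lenc by simp
    show "\<forall>R\<in>set X. sorted_wrt (<) R" using sorted_letter_positions by (auto simp: X_def)
    show "\<forall>r c. Suc r < length X \<and> c < length (X ! Suc r) \<longrightarrow> X ! r ! c < X ! Suc r ! c"
      using cols by (auto simp: lenX nthX)
  qed (fact dist)
  show thesis
  proof
    show "X \<in> SYT_max_rows l k" using std lenc lenX m by (simp add: SYT_max_rows_def)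
    show "row_word X = w"
    proof (rule nth_equalityI)
      show "length (row_word X) = length w" by (simp add: lenc len)
      show "row_word X ! j = w ! j" if "j < length (row_word X)" for j
      proof -
        have "j < length w" using that by (simp add: lenc len)
        then have "w ! j < m" "Suc j \<in> set (letter_positions w (w ! j))"
          using m nth_mem[of j w] by (auto simp: set_letter_positions)
        then show ?thesis using mem_row_iff[OF std, of j "w ! j"] that by (simp add: lenX nthX)
      qed
    qed
  qed
qed

lemma bij_betw_row_word: "bij_betw row_word (SYT_max_rows l k) (ballot_words l k)"
  unfolding bij_betw_def
proof
  show "inj_on row_word (SYT_max_rows l k)"
  proof (rule inj_onI)
    fix X Y assume "X \<in> SYT_max_rows l k" "Y \<in> SYT_max_rows l k" and eq: "row_word X = row_word Y"
    then have X: "standard_tableau X" and Y: "standard_tableau Y" by (auto simp: SYT_max_rows_def)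
    have "{..<length X} = {..<length Y}" using set_row_word[OF X] set_row_word[OF Y] eq by simp
    then have "length X = length Y" by simp
    then show "X = Y" using tableau_eq_letter_positions[OF X] tableau_eq_letter_positions[OF Y] eq by simp
  qed
  show "row_word ` SYT_max_rows l k = ballot_words l k"
    using row_word_ballot ballot_word_obtain_tableau by blast
qed

section \<open>The bijection and the enumeration\<close>

text \<open>
  The row numbered \<open>r\<close> from \<open>1\<close> in \<open>tau_move\<close> is the letter \<open>r - 1\<close>, so the rows
  \<open>2, \<dots>, i + 1\<close> are the letters \<open>1, \<dots>, i\<close>.
\<close>

lemma tau_move_eq:
  assumes X: "standard_tableau X" and j: "j < length (concat X)"
  shows "tau_move X i (Suc j) = (if row_word X ! j \<in> {1..i} then (0, 1) else (1, 0))"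
proof -
  have "(\<exists>r\<in>{2..i + 1}. r \<le> length X \<and> Suc j \<in> set (nth1 X r)) \<longleftrightarrow> row_word X ! j \<in> {1..i}"
    (is "?L \<longleftrightarrow> ?R")
  proof
    assume ?L
    then obtain r where r: "r \<in> {2..i + 1}" "r \<le> length X" "Suc j \<in> set (nth1 X r)" by blast
    then have "row_word X ! j = r - 1" using mem_row_iff[OF X j, of "r - 1"] by auto
    then show ?R using r(1) by auto
  next
    assume R: ?R
    have "row_word X ! j < length X \<and> Suc j \<in> set (X ! (row_word X ! j))"
      using mem_row_iff[OF X j, of "row_word X ! j"] by blast
    then show ?L using R by (intro bexI[of _ "Suc (row_word X ! j)"]) auto
  qed
  then show ?thesis unfolding tau_move_def by presburger
qed

lemma tau_half_nth:
  assumes X: "standard_tableau X" and l: "length (concat X) = l" and n: "n \<le> l"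
  shows "tau_half l X i ! n = half_vertex l (prefix_count (row_word X) {1..i}) n"
proof -
  have "(0, - int l) + (\<Sum>j = 1..n. tau_move X i j) =
      half_vertex l (prefix_count (row_word X) {1..i}) n"
    using n
  proof (induction n)
    case 0
    then show ?case by (simp add: half_vertex_def zero_prod_def)
  next
    case (Suc n)
    have IH: "(0, - int l) + (\<Sum>j = 1..n. tau_move X i j) =
        half_vertex l (prefix_count (row_word X) {1..i}) n" using Suc by simp
    have n: "n < length (concat X)" "n < length (row_word X)" using Suc.prems l length_row_word[of X] by simp_all
    have "(0, - int l) + (\<Sum>j = 1..Suc n. tau_move X i j) =
        half_vertex l (prefix_count (row_word X) {1..i}) n + tau_move X i (Suc n)"
      using IH by (simp add: add.assoc[symmetric])
    then show ?case
      unfolding tau_move_eq[OF X n(1)] half_vertex_def prefix_count_Suc[OF n(2)] by simp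
  qed
  then show ?thesis using n by (simp add: tau_half_def del: upt_Suc)
qed

lemma tau_path_eq_symmetric_path:
  assumes X: "standard_tableau X" and l: "length (concat X) = l"
  shows "tau_path l X i = symmetric_path l (prefix_count (row_word X) {1..i})"
proof (rule nth_equalityI)
  let ?u = "prefix_count (row_word X) {1..i}"
  have len: "length (tau_half l X i) = Suc l" by (simp add: tau_half_def)
  show "length (tau_path l X i) = length (symmetric_path l ?u)"
    by (simp add: tau_path_def len)
  fix n assume "n < length (tau_path l X i)"
  then have n: "n \<le> 2 * l" by (simp add: tau_path_def len)
  show "tau_path l X i ! n = symmetric_path l ?u ! n"
  proof (cases "n \<le> l")
    case True
    then show ?thesis using tau_half_nth[OF X l True]
      by (simp add: tau_path_def nth_append len symmetric_path_nth)
  next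
    case False
    then have m: "2 * l - n \<le> l" "2 * l - (2 * l - n) = n" using n by auto
    have "tau_path l X i ! n = tl (rev (map reflect (tau_half l X i))) ! (n - Suc l)"
      using False by (simp add: tau_path_def nth_append len)
    also have "\<dots> = rev (map reflect (tau_half l X i)) ! (n - l)"
      using False n by (subst nth_tl) (simp_all add: len Suc_diff_Suc)
    also have "\<dots> = reflect (tau_half l X i ! (2 * l - n))"
      using False n by (simp add: rev_nth len mult_2)
    also have "\<dots> = symmetric_path l ?u ! n"
      using tau_half_nth[OF X l m(1)] symmetric_path_nth(2)[OF m(1), of ?u] m(2) by simp
    finally show ?thesis .
  qed
qed

lemma tau_eq_paths_of_row_word:
  assumes "X \<in> SYT_max_rows l k"
  shows "tau l k X = paths_of_word l k (row_word X)"
proof -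
  have "standard_tableau X" "length (concat X) = l" using assms by (simp_all add: SYT_max_rows_def)
  then show ?thesis
    by (simp add: tau_def paths_of_word_def symmetric_paths_def tau_path_eq_symmetric_path)
qed

lemma bij_betw_tau:
  assumes "2 \<le> k"
  shows "bij_betw (tau l k) (SYT_max_rows l k) (SC_admissible l k)"
proof -
  have "bij_betw (paths_of_word l k \<circ> row_word) (SYT_max_rows l k) (SC_admissible l k)"
    using bij_betw_row_word bij_betw_paths_of_word[OF assms] by (rule bij_betw_trans)
  then show ?thesis by (rule bij_betw_cong[THEN iffD1, rotated]) (simp add: tau_eq_paths_of_row_word)
qed

lemma finite_SYT_max_rows: "finite (SYT_max_rows l k)"
proof -
  have "ballot_words l k \<subseteq> {w. set w \<subseteq> {..<k} \<and> length w = l}" by (auto simp: ballot_words_def)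
  then have "finite (ballot_words l k)" by (rule finite_subset) (simp add: finite_lists_length_eq)
  then show ?thesis using bij_betw_finite[OF bij_betw_row_word] by blast
qed

text \<open>
  For the color \<open>0\<close> the gaps count the letters of the whole word, that is, the row lengths.
\<close>

lemma seq_type_tau:
  assumes k: "2 \<le> k" and l: "1 \<le> l" and X: "X \<in> SYT_max_rows l k"
  shows "seq_type l k (tau l k X) = map length X @ replicate (k - length X) 0"
proof (rule nth_equalityI)
  have std: "standard_tableau X" and Xl: "length (concat X) = l" and Xk: "length X \<le> k"
    using X by (simp_all add: SYT_max_rows_def)
  let ?w = "row_word X"
  have w: "length ?w = l" "set ?w \<subseteq> {..<k}"
    using row_word_ballot[OF X] by (auto simp: ballot_words_def)
  show "length (seq_type l k (tau l k X)) = length (map length X @ replicate (k - length X) 0)"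
    using Xk by (simp add: seq_type_def)
  fix i assume "i < length (seq_type l k (tau l k X))"
  then have i: "i < k" by (simp add: seq_type_def)
  have "seq_type l k (tau l k X) ! i = prefix_count ?w {i} l"
    using tnum_paths_of_word[OF k w i, of 0] i l
    by (simp add: seq_type_def tau_eq_paths_of_row_word[OF X])
  also have "\<dots> = (map length X @ replicate (k - length X) 0) ! i"
  proof (cases "i < length X")
    case True
    then have "length (X ! i) = prefix_count ?w {i} l"
      using length_letter_positions[of ?w i] w(1) by (simp add: row_eq_letter_positions[OF std, symmetric])
    then show ?thesis using True by (simp add: nth_append)
  next
    case False
    then have "prefix_count ?w {i} l = 0"
      using set_row_word[OF std] by (intro prefix_count_empty_eq_0) auto
    then show ?thesis using False i by (simp add: nth_append)
  qed
  finally show "seq_type l k (tau l k X) ! i = (map length X @ replicate (k - length X) 0) ! i" .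
qed

lemma partition_eq_nonzero_parts_padded:
  fixes lam :: "nat list"
  assumes "sorted_wrt (\<ge>) lam"
  shows "lam = filter (\<lambda>m. m \<noteq> 0) lam @ replicate (length lam - length (filter (\<lambda>m. m \<noteq> 0) lam)) 0"
  using assms
proof (induction lam)
  case (Cons a lam)
  show ?case
  proof (cases "a = 0")
    case True
    then have "\<forall>x\<in>set lam. x = 0" using Cons.prems by simp
    then have "filter (\<lambda>m. m \<noteq> 0) lam = []" "replicate (length lam) 0 = lam"
      by (simp_all add: filter_empty_conv replicate_length_same)
    then show ?thesis using True by simp
  next
    case False
    have "sorted_wrt (\<ge>) lam" using Cons.prems by simp
    from Cons.IH[OF this] False show ?thesis
      by (metis (mono_tags, lifting) append_Cons diff_Suc_Suc filter.simps(2) length_Cons)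
  qed
qed simp

lemma SYT_shape_eq_type:
  assumes k: "2 \<le> k" and l: "1 \<le> l" and lam: "is_partition l lam" "length lam = k"
  shows "SYT_shape lam = {X \<in> SYT_max_rows l k. seq_type l k (tau l k X) = lam}"
proof -
  let ?parts = "filter (\<lambda>m. m \<noteq> 0) lam"
  have sum: "sum_list ?parts = l"
  proof -
    have "sum_list (filter (\<lambda>m. m \<noteq> 0) xs) = sum_list xs" for xs :: "nat list"
      by (induction xs) auto
    then show ?thesis using lam by (simp add: is_partition_def)
  qed
  have len: "length ?parts \<le> k" using lam(2) length_filter_le by metis
  have pad: "lam = ?parts @ replicate (k - length ?parts) 0"
    using partition_eq_nonzero_parts_padded[of lam] lam by (simp add: is_partition_def)
  show ?thesis
  proof (intro equalityI subsetI)
    fix X assume "X \<in> SYT_shape lam"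
    then have X: "standard_tableau X" "map length X = ?parts" by (auto simp: SYT_shape_def)
    then have lenX: "length X = length ?parts" using length_map by metis
    have mem: "X \<in> SYT_max_rows l k"
      using X sum len lenX by (simp add: SYT_max_rows_def length_concat)
    have "seq_type l k (tau l k X) = ?parts @ replicate (k - length ?parts) 0"
      unfolding seq_type_tau[OF k l mem] X(2) lenX ..
    also have "\<dots> = lam" using pad by (rule sym)
    finally show "X \<in> {X \<in> SYT_max_rows l k. seq_type l k (tau l k X) = lam}" using mem by simp
  next
    fix X assume "X \<in> {X \<in> SYT_max_rows l k. seq_type l k (tau l k X) = lam}"
    then have mem: "X \<in> SYT_max_rows l k" and eq: "seq_type l k (tau l k X) = lam" by auto
    have std: "standard_tableau X" using mem by (simp add: SYT_max_rows_def)
    have nonempty: "[] \<notin> set X" using std by (simp add: standard_tableau_def)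
    have "?parts = filter (\<lambda>m. m \<noteq> 0) (map length X @ replicate (k - length X) 0)"
      using seq_type_tau[OF k l mem] eq by simp
    also have "\<dots> = map length X" using nonempty by (auto simp: filter_id_conv filter_empty_conv)
    finally show "X \<in> SYT_shape lam" using std by (simp add: SYT_shape_def)
  qed
qed

lemma filter_nonzero_id: "0 \<notin> set lam \<Longrightarrow> filter (\<lambda>m. m \<noteq> 0) lam = (lam :: nat list)"
  by (rule filter_True) metis

lemma SYT_max_rows_eq_UN_shapes:
  "SYT_max_rows l k = (\<Union>lam\<in>{lam. is_partition l lam \<and> 0 \<notin> set lam \<and> ht lam \<le> k}. SYT_shape lam)"
proof (intro equalityI subsetI)
  fix X assume "X \<in> SYT_max_rows l k"
  then have X: "standard_tableau X" "length (concat X) = l" "length X \<le> k"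
    by (simp_all add: SYT_max_rows_def)
  have nonempty: "[] \<notin> set X" and "sorted_wrt (\<ge>) (map length X)"
    using X(1) by (simp_all add: standard_tableau_def)
  moreover have parts: "filter (\<lambda>m. m \<noteq> 0) (map length X) = map length X"
    using nonempty by (auto simp: filter_id_conv)
  ultimately have "map length X \<in> {lam. is_partition l lam \<and> 0 \<notin> set lam \<and> ht lam \<le> k}"
    using X by (auto simp: is_partition_def ht_def length_concat)
  moreover have "X \<in> SYT_shape (map length X)" using X(1) parts by (simp add: SYT_shape_def)
  ultimately show "X \<in> (\<Union>lam\<in>{lam. is_partition l lam \<and> 0 \<notin> set lam \<and> ht lam \<le> k}. SYT_shape lam)"
    by blast
next
  fix X assume "X \<in> (\<Union>lam\<in>{lam. is_partition l lam \<and> 0 \<notin> set lam \<and> ht lam \<le> k}. SYT_shape lam)"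
  then obtain lam where lam: "is_partition l lam" "0 \<notin> set lam" "ht lam \<le> k"
    and X: "standard_tableau X" "map length X = filter (\<lambda>m. m \<noteq> 0) lam"
    by (auto simp: SYT_shape_def)
  have "filter (\<lambda>m. m \<noteq> 0) lam = lam" using lam(2) by (rule filter_nonzero_id)
  then have "map length X = lam" using X by simp
  moreover have "length X \<le> k" using lam(3) X(2) unfolding ht_def by (metis length_map)
  ultimately show "X \<in> SYT_max_rows l k"
    using X(1) lam(1) by (simp add: SYT_max_rows_def is_partition_def length_concat)
qed

lemma finite_positive_partitions: "finite {lam. is_partition l lam \<and> 0 \<notin> set lam}"
proof -
  have "length lam \<le> sum_list lam" if "0 \<notin> set lam" for lam :: "nat list"
    using that by (induction lam) auto
  then have "{lam. is_partition l lam \<and> 0 \<notin> set lam} \<subseteq> {lam. set lam \<subseteq> {..l} \<and> length lam \<le> l}"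
    by (auto simp: is_partition_def member_le_sum_list)
  then show ?thesis by (rule finite_subset) (simp add: finite_lists_length_le)
qed

lemma card_SYT_max_rows:
  "card (SYT_max_rows l k) = (\<Sum>lam | is_partition l lam \<and> 0 \<notin> set lam \<and> ht lam \<le> k. num_SYT lam)"
proof -
  let ?L = "{lam. is_partition l lam \<and> 0 \<notin> set lam \<and> ht lam \<le> k}"
  have "finite ?L" by (rule finite_subset[OF _ finite_positive_partitions[of l]]) auto
  moreover have "\<forall>lam\<in>?L. finite (SYT_shape lam)"
  proof
    fix lam assume "lam \<in> ?L"
    then have "SYT_shape lam \<subseteq> SYT_max_rows l k" unfolding SYT_max_rows_eq_UN_shapes by blast
    then show "finite (SYT_shape lam)" using finite_SYT_max_rows by (rule finite_subset)
  qed
  moreover have "\<forall>lam\<in>?L. \<forall>mu\<in>?L. lam \<noteq> mu \<longrightarrow> SYT_shape lam \<inter> SYT_shape mu = {}"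
  proof (intro ballI impI)
    fix lam mu assume "lam \<in> ?L" "mu \<in> ?L" "lam \<noteq> mu"
    then have "filter (\<lambda>m. m \<noteq> 0) lam = lam" "filter (\<lambda>m. m \<noteq> 0) mu = mu"
      using filter_nonzero_id by blast+
    then show "SYT_shape lam \<inter> SYT_shape mu = {}" using \<open>lam \<noteq> mu\<close> by (auto simp: SYT_shape_def)
  qed
  ultimately show ?thesis
    unfolding SYT_max_rows_eq_UN_shapes num_SYT_def by (rule card_UN_disjoint)
qed

theorem theorem2p4:
  fixes l k :: nat
  assumes "l \<ge> 1" and "k \<ge> 2"
  shows "bij_betw (tau l k) (SYT_max_rows l k) (SC_admissible l k)
    \<and> card (SC_admissible l k)
        = (\<Sum>lam | is_partition l lam \<and> 0 \<notin> set lam \<and> ht lam \<le> k. num_SYT lam)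
    \<and> (\<forall>lam. is_partition l lam \<and> length lam = k \<longrightarrow>
        card {ps \<in> SC_admissible l k. seq_type l k ps = lam} = num_SYT lam)"
proof (intro conjI allI impI)
  show bij: "bij_betw (tau l k) (SYT_max_rows l k) (SC_admissible l k)"
    using assms(2) by (rule bij_betw_tau)
  show "card (SC_admissible l k)
      = (\<Sum>lam | is_partition l lam \<and> 0 \<notin> set lam \<and> ht lam \<le> k. num_SYT lam)"
    using bij_betw_same_card[OF bij] card_SYT_max_rows by simp
  fix lam assume lam: "is_partition l lam \<and> length lam = k"
  have shape: "SYT_shape lam = {X \<in> SYT_max_rows l k. seq_type l k (tau l k X) = lam}"
    using SYT_shape_eq_type assms lam by blast
  have "tau l k ` SYT_shape lam = {ps \<in> SC_admissible l k. seq_type l k ps = lam}"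
    unfolding shape using bij by (auto simp: bij_betw_def)
  moreover have "inj_on (tau l k) (SYT_shape lam)"
    using bij unfolding shape by (auto simp: bij_betw_def intro: inj_on_subset)
  ultimately show "card {ps \<in> SC_admissible l k. seq_type l k ps = lam} = num_SYT lam"
    unfolding num_SYT_def by (metis card_image)
qed

end
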